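(* Let $I=(N,O,L,W)$ be any instance of the weighted House Allocation problem in which agents' preference lists may contain ties. Let $\mu$ be the random matching returned by the mechanism Random SDMT-2 on $I$ (defined in the context). Then Random SDMT-2 has approximation ratio at most $\frac{e}{e-1}$, i.e. $\mathbb{E}[w(\mu)]\ge \left(1-\frac1e\right) w(I)$, where $w(\mu)$ is the weight of $\mu$ and $w(I)$ is the maximum weight of a matching in $I$.
   Context: House Allocation (HA). $N=\{1,\dots,n_1\}$ is a finite set of agents and $O=\{o_1,\dots,o_{n_2}\}$ a finite set of objects. Each agent $i$ has a preference list $L(i)=(C^i_1\succ_i C^i_2\succ_i\cdots)$, an ordered sequence of pairwise disjoint subsets of $O$ (indifference classes, or ties); objects in $C^i_k$ are strictly preferred to those in $C^i_l$ for $k<l$, and $i$ is indifferent between objects in the same class; if $C^i_l=\emptyset$ then $C^i_q=\emptyset$ for all $q\ge l$ and $C^i_{n_2+1}=\emptyset$. Objects in $\bigcup_k C^i_k$ are acceptable to $i$ (we write $o\in L(i)$). A matching is a set of (agent, acceptable object) pairs in which every agent and every object occurs at most once. Each agent $i$ has a weight $w_i>0$, $W=(w_1,\dots,w_{n_1})$; the weight of a matching is the sum of the weights of its matched agents. Trading graphs. During SDMT-2 agents are temporarily allocated sets of objects ("own" them), all objects owned by an agent lying in one of his indifference classes. An agent owning more than one object is called labelled, otherwise unlabelled. For an agent $i$, a set $S$ of agents with $i\notin S$, and $B\subseteq L(i)$, the trading graph $TG(i,B,S)$ is the directed graph on $\{i\}\cup S$ built as follows: $i$ points to each agent in $S$ owning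 an object of $B$; each unlabelled agent $j\in S$ that is pointed to, whose owned object lies in $C^j_k$, points to each agent in $S$ owning an object of $C^j_k$ not owned by $j$; this is repeated for newly pointed-to unlabelled agents until nothing changes. Labelled agents point to nobody. Write $TG(i,a,S)=TG(i,\{a\},S)$. Fix a common strict order on all objects (used only for tie-breaking). Let $H$ be the set of $a\in L(i)$ such that $TG(i,a,S)$ contains a directed path from $i$ to a labelled agent. If $H=\emptyset$, put $\max TG(i,L(i),S)=\emptyset$. Otherwise let $\ell$ be the smallest index with $H\cap C^i_\ell\ne\emptyset$; $\max TG(i,L(i),S)$ is the highest object of $H\cap C^i_\ell$ in the common order. $Trading(i,a,S)$: take a simple directed path $(i=i_0,i_1,\dots,i_k)$ in $TG(i,a,S)$ with only $i_k$ labelled (e.g. found by breadth-first search); for $s=0,\dots,k-1$ the object owned by $i_{s+1}$ is given to $i_s$, where $i_{k-1}$ receives the highest object in the common order among those owned by $i_k$ because of which $i_{k-1}$ points to $i_k$; afterwards $i_k$ remains labelled iff he still owns more than one object. SDMT-2, given an order of the agents: initially all objects are unallocated. Process agents in the given order. When agent $i$ is processed, let $O_i$ be the set of currently unallocated objects and $S$ the set of previously processed agents. Let $j_1$ be the smallest $j$ with $O_i\cap C^i_j\neq\emptyset$ ($j_1=n_2+1$ if none), and let $j_2$ be the index of the class $C^i_{j_2}$ containing $\max TG(i,L(i),S)$ ($j_2=n_2+1$ if $\max TG(i,L(i),S)=\emptyset$). If $j_1\le j_2$, allocate all objects of $O_i\cap C^i_{j_1}$ to $i$. Otherwise perform $Trading(i,\max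 TG(i,L(i),S),S)$. After all agents are processed, each labelled agent is matched to the highest object he owns in the common order, each unlabelled agent owning one object is matched to it, and all others are unmatched. Random SDMT-2: draw $Y_i$, $i\in N$, independently and uniformly from $[0,1]$; sort the agents in decreasing order of $w_i(1-e^{Y_i-1})$, breaking ties in favour of the smaller index; run SDMT-2 with this order and return its matching. *)

theory Defs
  imports "HOL-Probability.Probability"
begin

section \<open>House allocation with ties\<close>

text \<open>
  The agents are the naturals from 1 to \<open>num_agents\<close>; \<open>pref I i k\<close> is the \<open>k\<close>-th indifference
  class of agent \<open>i\<close>, for \<open>k \<ge> 1\<close>.  The value at \<open>k = 0\<close> is never used.
\<close>

record 'o ha =
  num_agents :: nat
  objects :: "'o set"
  pref :: "nat \<Rightarrow> nat \<Rightarrow> 'o set"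
  weight :: "nat \<Rightarrow> real"

definition agents :: "'o ha \<Rightarrow> nat set" where
  "agents I = {1..num_agents I}"

definition num_objects :: "'o ha \<Rightarrow> nat" where
  "num_objects I = card (objects I)"

definition acceptable :: "'o ha \<Rightarrow> nat \<Rightarrow> 'o set" where
  "acceptable I i = (\<Union>k\<in>{1..}. pref I i k)"

definition ha_instance :: "'o ha \<Rightarrow> bool" where
  "ha_instance I \<longleftrightarrow>
     finite (objects I) \<and>
     (\<forall>i\<in>agents I.
        (\<forall>k\<ge>1. pref I i k \<subseteq> objects I) \<and>
        disjoint_family_on (pref I i) {1..} \<and>
        (\<forall>l\<ge>1. pref I i l = {} \<longrightarrow> (\<forall>q\<ge>l. pref I i q = {})) \<and>
        pref I i (num_objects I + 1) = {} \<and>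
        weight I i > 0)"

definition is_matching :: "'o ha \<Rightarrow> (nat \<times> 'o) set \<Rightarrow> bool" where
  "is_matching I M \<longleftrightarrow>
     M \<subseteq> Sigma (agents I) (acceptable I) \<and> inj_on fst M \<and> inj_on snd M"

definition matching_weight :: "'o ha \<Rightarrow> (nat \<times> 'o) set \<Rightarrow> real" where
  "matching_weight I M = (\<Sum>i\<in>Domain M. weight I i)"

definition opt_weight :: "'o ha \<Rightarrow> real" where
  "opt_weight I = Max (matching_weight I ` {M. is_matching I M})"


section \<open>Trading graphs\<close>

text \<open>
  An ownership state \<open>own\<close> maps each agent to the set of objects he currently owns.  The common
  order \<open>r\<close> of the objects is strict, and \<open>(a, b) \<in> r\<close> means that \<open>b\<close> is higher than \<open>a\<close>.
\<close>

definition highest :: "'o rel \<Rightarrow> 'o set \<Rightarrow> 'o" where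
  "highest r A = (THE a. a \<in> A \<and> (\<forall>b\<in>A. b \<noteq> a \<longrightarrow> (b, a) \<in> r))"

definition labelled :: "(nat \<Rightarrow> 'o set) \<Rightarrow> nat \<Rightarrow> bool" where
  "labelled own j \<longleftrightarrow> card (own j) > 1"

inductive_set trading_graph ::
  "'o ha \<Rightarrow> (nat \<Rightarrow> 'o set) \<Rightarrow> nat \<Rightarrow> 'o set \<Rightarrow> nat set \<Rightarrow> nat rel"
  for I :: "'o ha" and own :: "nat \<Rightarrow> 'o set" and i :: nat and B :: "'o set" and S :: "nat set"
where
  start: "j \<in> S \<Longrightarrow> own j \<inter> B \<noteq> {} \<Longrightarrow> (i, j) \<in> trading_graph I own i B S"
| step: "(h, j) \<in> trading_graph I own i B S \<Longrightarrow> \<not> labelled own j \<Longrightarrow>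
         k \<ge> 1 \<Longrightarrow> own j \<inter> pref I j k \<noteq> {} \<Longrightarrow>
         m \<in> S \<Longrightarrow> own m \<inter> (pref I j k - own j) \<noteq> {} \<Longrightarrow>
         (j, m) \<in> trading_graph I own i B S"

definition tradable :: "'o ha \<Rightarrow> (nat \<Rightarrow> 'o set) \<Rightarrow> nat \<Rightarrow> nat set \<Rightarrow> 'o set" where
  "tradable I own i S =
     {a \<in> acceptable I i. \<exists>l. labelled own l \<and> (i, l) \<in> (trading_graph I own i {a} S)\<^sup>+}"

text \<open>\<open>max TG(i, L(i), S)\<close>; the value \<open>None\<close> stands for the empty set.\<close>

definition max_TG ::
  "'o ha \<Rightarrow> 'o rel \<Rightarrow> (nat \<Rightarrow> 'o set) \<Rightarrow> nat \<Rightarrow> nat set \<Rightarrow> 'o option" where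
  "max_TG I r own i S =
     (let H = tradable I own i S in
      if H = {} then None
      else Some (highest r (H \<inter> pref I i (LEAST l. l \<ge> 1 \<and> H \<inter> pref I i l \<noteq> {}))))"

definition trading_path ::
  "'o ha \<Rightarrow> (nat \<Rightarrow> 'o set) \<Rightarrow> nat \<Rightarrow> 'o \<Rightarrow> nat set \<Rightarrow> nat list \<Rightarrow> bool" where
  "trading_path I own i a S p \<longleftrightarrow>
     length p \<ge> 2 \<and> hd p = i \<and> distinct p \<and>
     successively (\<lambda>x y. (x, y) \<in> trading_graph I own i {a} S) p \<and>
     labelled own (last p) \<and> (\<forall>j\<in>set (butlast p). \<not> labelled own j)"

text \<open>The objects owned by \<open>y\<close> because of which \<open>x\<close> points to \<open>y\<close> in \<open>TG(i, a, S)\<close>.\<close>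

definition pointing_objects ::
  "'o ha \<Rightarrow> (nat \<Rightarrow> 'o set) \<Rightarrow> nat \<Rightarrow> 'o \<Rightarrow> nat \<Rightarrow> nat \<Rightarrow> 'o set" where
  "pointing_objects I own i a x y =
     (if x = i then own y \<inter> {a}
      else {b \<in> own y - own x. \<exists>k\<ge>1. own x \<inter> pref I x k \<noteq> {} \<and> b \<in> pref I x k})"

text \<open>
  All transfers along the path are simultaneous: every occurrence of \<open>own\<close> on a right-hand side
  refers to the state before trading.  Interior agents of a trading path own exactly one object,
  so \<open>x := own y\<close> hands over that object.
\<close>

fun trade ::
  "'o ha \<Rightarrow> 'o rel \<Rightarrow> (nat \<Rightarrow> 'o set) \<Rightarrow> nat \<Rightarrow> 'o \<Rightarrow> nat list \<Rightarrow> (nat \<Rightarrow> 'o set)" where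
  "trade I r own i a (x # y # z # p) = (trade I r own i a (y # z # p))(x := own y)"
| "trade I r own i a [x, y] =
     (let b = highest r (pointing_objects I own i a x y)
      in own(x := {b}, y := own y - {b}))"
| "trade I r own i a _ = own"


section \<open>SDMT-2\<close>

text \<open>
  \<open>Trading(i, a, S)\<close> may use any suitable path.  This freedom is represented by a path rule \<open>P\<close>,
  which may depend on the sequence of previously processed agents, on the current ownership, and
  on \<open>i\<close> and \<open>a\<close>.
\<close>

type_synonym 'o path_rule = "nat list \<Rightarrow> (nat \<Rightarrow> 'o set) \<Rightarrow> nat \<Rightarrow> 'o \<Rightarrow> nat list"

definition valid_path_rule :: "'o ha \<Rightarrow> 'o path_rule \<Rightarrow> bool" where
  "valid_path_rule I P \<longleftrightarrow>
     (\<forall>ps own i a. (\<exists>p. trading_path I own i a (set ps) p) \<longrightarrow>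
        trading_path I own i a (set ps) (P ps own i a))"

definition sdmt2_step ::
  "'o ha \<Rightarrow> 'o rel \<Rightarrow> 'o path_rule \<Rightarrow> nat list \<Rightarrow> (nat \<Rightarrow> 'o set) \<Rightarrow> nat \<Rightarrow> (nat \<Rightarrow> 'o set)" where
  "sdmt2_step I r P ps own i =
     (let Oi = objects I - (\<Union>j. own j);
          m = max_TG I r own i (set ps);
          j1 = (if \<exists>j\<ge>1. Oi \<inter> pref I i j \<noteq> {} then LEAST j. j \<ge> 1 \<and> Oi \<inter> pref I i j \<noteq> {}
                else num_objects I + 1);
          j2 = (case m of None \<Rightarrow> num_objects I + 1 | Some a \<Rightarrow> THE j. j \<ge> 1 \<and> a \<in> pref I i j)
      in if j1 \<le> j2 then own(i := Oi \<inter> pref I i j1)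
         else trade I r own i (the m) (P ps own i (the m)))"

text \<open>The first list contains the agents already processed, the second those still to come.\<close>

fun sdmt2_run ::
  "'o ha \<Rightarrow> 'o rel \<Rightarrow> 'o path_rule \<Rightarrow> nat list \<Rightarrow> (nat \<Rightarrow> 'o set) \<Rightarrow> nat list \<Rightarrow> (nat \<Rightarrow> 'o set)" where
  "sdmt2_run I r P ps own [] = own"
| "sdmt2_run I r P ps own (i # is) =
     sdmt2_run I r P (ps @ [i]) (sdmt2_step I r P ps own i) is"

text \<open>An unlabelled agent owning one object is matched to it, since it is his highest object.\<close>

definition sdmt2 :: "'o ha \<Rightarrow> 'o rel \<Rightarrow> 'o path_rule \<Rightarrow> nat list \<Rightarrow> (nat \<times> 'o) set" where
  "sdmt2 I r P is =
     (let own = sdmt2_run I r P [] (\<lambda>_. {}) is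
      in {(i, highest r (own i)) | i. i \<in> set is \<and> own i \<noteq> {}})"


section \<open>Random SDMT-2\<close>

text \<open>Ties go to the smaller index because \<open>sort_key\<close> is stable.\<close>

definition agent_order :: "'o ha \<Rightarrow> (nat \<Rightarrow> real) \<Rightarrow> nat list" where
  "agent_order I Y =
     sort_key (\<lambda>i. - (weight I i * (1 - exp (Y i - 1)))) [1..<num_agents I + 1]"

definition draws :: "'o ha \<Rightarrow> (nat \<Rightarrow> real) measure" where
  "draws I = (\<Pi>\<^sub>M i\<in>agents I. uniform_measure lborel {0..1})"

definition random_sdmt2 ::
  "'o ha \<Rightarrow> 'o rel \<Rightarrow> 'o path_rule \<Rightarrow> (nat \<Rightarrow> real) \<Rightarrow> (nat \<times> 'o) set" where
  "random_sdmt2 I r P Y = sdmt2 I r P (agent_order I Y)"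

end

theory Submission
  imports Defs
begin

text \<open>
  Call an allocated object dead if its owner is unlabelled and reaches no labelled agent.  An arriving
  agent always obtains the best of his classes that contains an object which is not dead (whatever
  trading path is used), dead objects never change hands again, and inserting a further agent into
  the processing order can only make more objects dead.

  The bound then follows by a randomized primal-dual argument with \<open>g y = exp (y - 1)\<close>.  The weight
  \<open>w\<^sub>j\<close> of a matched agent is split into a share \<open>w\<^sub>j * g Y\<^sub>j\<close> kept by \<open>j\<close> and a share
  \<open>w\<^sub>j * (1 - g Y\<^sub>j)\<close>, his sorting key, given to his object if he owns a single one.  For an edge
  \<open>(i, a)\<close> of an optimal matching fix all draws but \<open>Y\<^sub>i\<close>, and let \<open>c\<close> be the key of the agent at whose
  arrival \<open>a\<close> dies when \<open>i\<close> is left out.  If the key of \<open>i\<close> exceeds \<open>c\<close> then \<open>i\<close> is matched, and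
  \<open>a\<close> receives at least \<open>c\<close> in any case; integrating over \<open>Y\<^sub>i\<close> gives \<open>(1 - 1/e) w\<^sub>i\<close>.
\<close>

section \<open>Trading graphs and dead objects\<close>

lemma rtrancl_simple_path:
  assumes "(x, y) \<in> R\<^sup>*"
  shows "\<exists>p. p \<noteq> [] \<and> hd p = x \<and> last p = y \<and> distinct p \<and> successively (\<lambda>u v. (u, v) \<in> R) p"
  using assms
proof (induction rule: converse_rtrancl_induct)
  case base
  show ?case by (rule exI[of _ "[y]"]) auto
next
  case (step x z)
  then obtain p where p: "p \<noteq> []" "hd p = z" "last p = y" "distinct p"
    "successively (\<lambda>u v. (u, v) \<in> R) p" by blast
  show ?case
  proof (cases "x \<in> set p")
    case True
    \<comment> \<open>Cutting off everything before the earlier occurrence of \<open>x\<close>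
      leaves a simple path.\<close>
    then obtain us vs where "p = us @ x # vs" by (meson split_list)
    with p show ?thesis
      by (intro exI[of _ "x # vs"]) (auto simp: successively_append_iff)
  next
    case False
    with p step show ?thesis
      by (intro exI[of _ "x # p"]) (auto simp: successively_Cons)
  qed
qed

lemma successively_butlast_ex:
  assumes "successively Q p" "j \<in> set (butlast p)"
  shows "\<exists>z\<in>set p. Q j z"
  using assms by (induction p rule: induct_list012) (auto split: if_splits)

lemma successively_reaches_last:
  assumes "successively (\<lambda>u v. (u, v) \<in> R) p" "j \<in> set p"
  shows "(j, last p) \<in> R\<^sup>*"
  using assms
proof (induction p arbitrary: j rule: induct_list012)
  case (3 x y zs)
  have "(y, last (y # zs)) \<in> R\<^sup>*" using 3(2)[of y] 3(3) by simp
  moreover have "(x, y) \<in> R" using 3(3) by simp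
  ultimately have "(x, last (y # zs)) \<in> R\<^sup>*" by (rule converse_rtrancl_into_rtrancl[rotated])
  with 3 show ?case by auto
qed auto

text \<open>\<open>highest\<close> is a definite description: a maximum exists by induction on the
  finite set, and transitivity with irreflexivity forbids a second one.\<close>

lemma highest_mem:
  assumes "strict_linear_order_on X r" "A \<subseteq> X" "finite A" "A \<noteq> {}"
  shows "highest r A \<in> A"
proof -
  have tr: "trans r" and irr: "irrefl r" and tot: "total_on X r"
    using assms(1) by (auto simp: strict_linear_order_on_def)
  have "\<exists>a\<in>A. \<forall>b\<in>A. b \<noteq> a \<longrightarrow> (b, a) \<in> r"
    using assms(3,4,2)
  proof (induction rule: finite_ne_induct)
    case (insert x F)
    then obtain a where a: "a \<in> F" "\<forall>b\<in>F. b \<noteq> a \<longrightarrow> (b, a) \<in> r" by auto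
    have "x \<noteq> a" "x \<in> X" "a \<in> X" using insert a by auto
    then consider "(x, a) \<in> r" | "(a, x) \<in> r" using tot by (auto simp: total_on_def)
    then show ?case
    proof cases
      case 1 then show ?thesis using a by auto
    next
      case 2
      then have "\<forall>b\<in>insert x F. b \<noteq> x \<longrightarrow> (b, x) \<in> r"
        using a tr by (metis insert_iff transE)
      then show ?thesis by blast
    qed
  qed auto
  then obtain a where a: "a \<in> A" "\<forall>b\<in>A. b \<noteq> a \<longrightarrow> (b, a) \<in> r" by blast
  have "highest r A = a"
    unfolding highest_def
  proof (rule the_equality)
    fix a' assume a': "a' \<in> A \<and> (\<forall>b\<in>A. b \<noteq> a' \<longrightarrow> (b, a') \<in> r)"
    show "a' = a"
    proof (rule ccontr)
      assume "a' \<noteq> a"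
      then have "(a', a) \<in> r" "(a, a') \<in> r" using a a' by auto
      then show False using tr irr by (meson irrefl_def transD)
    qed
  qed (use a in auto)
  with a show ?thesis by simp
qed

lemma trading_graph_target:
  "(x, y) \<in> trading_graph I own i B S \<Longrightarrow> y \<in> S \<and> (x = i \<or> x \<in> S)"
  by (induction rule: trading_graph.induct) auto

text \<open>The rule \<open>step\<close> only gives edges leaving an agent who is already pointed
  to, hence a member of \<open>S\<close>. As \<open>i\<close> lies outside \<open>S\<close>, all his
  edges come from \<open>start\<close>.\<close>

lemma trading_graph_startD:
  assumes "(i, y) \<in> trading_graph I own i B S" "i \<notin> S"
  shows "own y \<inter> B \<noteq> {}"
  using assms by (cases rule: trading_graph.cases) (auto dest: trading_graph_target)

lemma trading_graph_stepD:
  assumes "(x, y) \<in> trading_graph I own i B S" "x \<noteq> i"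
  shows "\<not> labelled own x"
    and "\<exists>k\<ge>1. own x \<inter> pref I x k \<noteq> {} \<and> own y \<inter> (pref I x k - own x) \<noteq> {}"
  using assms by (cases rule: trading_graph.cases; blast)+

section \<open>A fixed instance, tight sets and valid states\<close>

locale house_allocation =
  fixes I :: "'o ha" and r :: "'o rel" and P :: "'o path_rule"
  assumes inst: "ha_instance I"
    and lin: "strict_linear_order_on (objects I) r"
    and path_rule: "valid_path_rule I P"
begin

lemma finite_objects: "finite (objects I)"
  using inst by (simp add: ha_instance_def)

lemma pref_subset: "i \<in> agents I \<Longrightarrow> k \<ge> 1 \<Longrightarrow> pref I i k \<subseteq> objects I"
  using inst by (simp add: ha_instance_def)

lemma pref_unique:
  "i \<in> agents I \<Longrightarrow> k \<ge> 1 \<Longrightarrow> l \<ge> 1 \<Longrightarrow> x \<in> pref I i k \<Longrightarrow> x \<in> pref I i l \<Longrightarrow> k = l"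
  using inst unfolding ha_instance_def disjoint_family_on_def by (metis IntI atLeast_iff empty_iff)

lemma pref_empty: "i \<in> agents I \<Longrightarrow> k \<ge> num_objects I + 1 \<Longrightarrow> pref I i k = {}"
  using inst unfolding ha_instance_def by (metis le_add2)

lemma weight_pos: "i \<in> agents I \<Longrightarrow> weight I i > 0"
  using inst by (simp add: ha_instance_def)

text \<open>The indifference class in which \<open>j\<close> currently owns. The union form yields
  the empty set for an agent without objects; in a valid state at most one class is met.\<close>

definition cl :: "(nat \<Rightarrow> 'o set) \<Rightarrow> nat \<Rightarrow> 'o set" where
  "cl own j = (\<Union>k\<in>{k. k \<ge> 1 \<and> own j \<inter> pref I j k \<noteq> {}}. pref I j k)"

text \<open>The dead objects are the largest tight set: from the owner of an object in a tight set the
  trading graph leads only to owners of objects in the set, none of whom is labelled.\<close>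

definition tight :: "(nat \<Rightarrow> 'o set) \<Rightarrow> 'o set \<Rightarrow> bool" where
  "tight own X \<longleftrightarrow> (\<forall>x\<in>X. \<exists>j. own j = {x} \<and> cl own j \<subseteq> X)"

definition dead :: "(nat \<Rightarrow> 'o set) \<Rightarrow> 'o set" where
  "dead own = \<Union>{X. tight own X}"

text \<open>With \<open>D\<close> the set of dead objects, this is the class in which an arriving
  agent \<open>i\<close> obtains his objects, see \<open>step_spec\<close>.\<close>

definition pick :: "nat \<Rightarrow> 'o set \<Rightarrow> 'o set" where
  "pick i D = (if \<exists>k\<ge>1. \<not> pref I i k \<subseteq> D
               then pref I i (LEAST k. k \<ge> 1 \<and> \<not> pref I i k \<subseteq> D) else {})"

text \<open>The last condition persists because an agent who starts to own in a class leaves no free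
  object in it, and allocated objects never become free again. It makes the set of reachable objects
  closed under \<open>cl\<close> in \<open>tradable_iff\<close>.\<close>

definition valid_state :: "nat set \<Rightarrow> (nat \<Rightarrow> 'o set) \<Rightarrow> bool" where
  "valid_state S own \<longleftrightarrow>
     S \<subseteq> agents I \<and> (\<forall>j. j \<notin> S \<longrightarrow> own j = {}) \<and> disjoint_family own \<and>
     (\<forall>j. \<exists>k\<ge>1. own j \<subseteq> pref I j k) \<and> (\<forall>j. cl own j \<subseteq> (\<Union>j. own j))"

text \<open>Tightness survives unions, since enlarging \<open>X\<close> only weakens the demand on
  \<open>cl\<close>; so there is a largest tight set.\<close>

lemma tight_dead: "tight own (dead own)"
  unfolding tight_def
proof
  fix x assume "x \<in> dead own"
  then obtain X where "x \<in> X" "tight own X" by (auto simp: dead_def)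
  then obtain j where "own j = {x}" "cl own j \<subseteq> X" by (auto simp: tight_def)
  moreover have "X \<subseteq> dead own" using \<open>tight own X\<close> by (auto simp: dead_def)
  ultimately show "\<exists>j. own j = {x} \<and> cl own j \<subseteq> dead own" by blast
qed

lemma tight_subset_dead: "tight own X \<Longrightarrow> X \<subseteq> dead own"
  unfolding dead_def by blast

lemma deadE:
  assumes "x \<in> dead own"
  obtains j where "own j = {x}" "cl own j \<subseteq> dead own"
  using tight_dead assms unfolding tight_def by blast

lemma cl_eq:
  assumes "j \<in> agents I" "k \<ge> 1" "own j \<inter> pref I j k \<noteq> {}" "own j \<subseteq> pref I j l" "l \<ge> 1"
  shows "cl own j = pref I j k"
proof -
  have "k = l" using assms pref_unique by blast
  moreover have "k' = l" if "k' \<ge> 1" "own j \<inter> pref I j k' \<noteq> {}" for k'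
    using that assms pref_unique by blast
  ultimately have "{k. k \<ge> 1 \<and> own j \<inter> pref I j k \<noteq> {}} = {k}" using assms by auto
  then show ?thesis by (simp add: cl_def)
qed

lemma cl_empty: "own j = {} \<Longrightarrow> cl own j = {}"
  by (auto simp: cl_def)

lemma valid_own_subset_cl:
  assumes "valid_state S own" shows "own j \<subseteq> cl own j"
  using assms unfolding valid_state_def cl_def by fastforce

lemma valid_own_objects:
  assumes "valid_state S own" shows "own j \<subseteq> objects I"
proof (cases "j \<in> S")
  case True
  with assms obtain k where "k \<ge> 1" "own j \<subseteq> pref I j k" "j \<in> agents I"
    unfolding valid_state_def by blast
  then show ?thesis using pref_subset by blast
qed (use assms in \<open>auto simp: valid_state_def\<close>)

lemma valid_finite: "valid_state S own \<Longrightarrow> finite (own j)"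
  using valid_own_objects finite_objects finite_subset by metis

lemma valid_disjoint:
  "valid_state S own \<Longrightarrow> x \<in> own j \<Longrightarrow> x \<in> own k \<Longrightarrow> j = k"
  unfolding valid_state_def disjoint_family_on_def by blast

lemma valid_cl:
  assumes "valid_state S own" "own j \<inter> pref I j k \<noteq> {}" "k \<ge> 1"
  shows "cl own j = pref I j k"
proof -
  have "j \<in> agents I" using assms by (auto simp: valid_state_def)
  moreover obtain l where "l \<ge> 1" "own j \<subseteq> pref I j l"
    using assms(1) unfolding valid_state_def by blast
  ultimately show ?thesis using assms by (intro cl_eq) auto
qed

lemma unlabelled_singleton:
  "valid_state S own \<Longrightarrow> \<not> labelled own j \<Longrightarrow> x \<in> own j \<Longrightarrow> own j = {x}"
  using valid_finite[of S own j] unfolding labelled_def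
  by (auto simp: not_less card_le_Suc0_iff_eq)

section \<open>Dead objects and reachability of labelled agents\<close>

text \<open>The class of the owner of a dead object is entirely dead, and \<open>x\<close> points
  only to owners of objects in his class.\<close>

lemma dead_edge:
  assumes v: "valid_state S own" and e: "(x, y) \<in> trading_graph I own i B S" and "x \<noteq> i"
    and x: "own x \<inter> dead own \<noteq> {}"
  shows "own y \<inter> dead own \<noteq> {}"
proof -
  obtain k where k: "k \<ge> 1" "own x \<inter> pref I x k \<noteq> {}" "own y \<inter> (pref I x k - own x) \<noteq> {}"
    using trading_graph_stepD[OF e \<open>x \<noteq> i\<close>] by blast
  obtain z where z: "z \<in> own x" "z \<in> dead own" using x by blast
  obtain j where j: "own j = {z}" "cl own j \<subseteq> dead own" using z(2) by (rule deadE)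
  have "j = x" using valid_disjoint[OF v] j z by blast
  then have "pref I x k \<subseteq> dead own" using j valid_cl[OF v k(2,1)] by simp
  then show ?thesis using k by blast
qed

lemma dead_unlabelled:
  assumes v: "valid_state S own" and x: "own x \<inter> dead own \<noteq> {}"
  shows "\<not> labelled own x"
proof -
  obtain z where z: "z \<in> own x" "z \<in> dead own" using x by blast
  obtain j where j: "own j = {z}" using z(2) by (rule deadE)
  have "j = x" using valid_disjoint[OF v] j z by blast
  then show ?thesis using j by (simp add: labelled_def)
qed

lemma dead_reach:
  assumes v: "valid_state S own" and i: "i \<notin> S" and "x \<noteq> i"
    and e: "(x, y) \<in> (trading_graph I own i B S)\<^sup>*" and x: "own x \<inter> dead own \<noteq> {}"
  shows "own y \<inter> dead own \<noteq> {}"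
proof -
  from e have "y \<noteq> i \<and> own y \<inter> dead own \<noteq> {}"
  proof (induction rule: rtrancl_induct)
    case (step y z)
    then show ?case using dead_edge[OF v step(2)] trading_graph_target[OF step(2)] i by auto
  qed (use assms in auto)
  then show ?thesis by simp
qed

text \<open>A walk starting at the owner of a dead object meets only owners of dead objects, and
  these are unlabelled. Conversely, if no labelled agent is reachable, the objects of the reachable
  agents form a tight set containing \<open>a\<close>.\<close>

lemma tradable_iff:
  assumes v: "valid_state S own" and i: "i \<notin> S"
    and a: "a \<in> acceptable I i" "a \<in> own q"
  shows "a \<in> tradable I own i S \<longleftrightarrow> a \<notin> dead own"
proof
  let ?T = "trading_graph I own i {a} S"
  assume "a \<in> tradable I own i S"
  then obtain l where l: "labelled own l" "(i, l) \<in> ?T\<^sup>+" by (auto simp: tradable_def)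
  show "a \<notin> dead own"
  proof
    assume d: "a \<in> dead own"
    from l(2) obtain x where x: "(i, x) \<in> ?T" "(x, l) \<in> ?T\<^sup>*" by (meson tranclD)
    have "own x \<inter> {a} \<noteq> {}" using trading_graph_startD[OF x(1) i] .
    moreover have "x \<noteq> i" using trading_graph_target[OF x(1)] i by auto
    ultimately have "own l \<inter> dead own \<noteq> {}" using dead_reach[OF v i _ x(2)] d by blast
    then show False using dead_unlabelled[OF v] l by blast
  qed
next
  let ?T = "trading_graph I own i {a} S"
  assume nd: "a \<notin> dead own"
  show "a \<in> tradable I own i S"
  proof (rule ccontr)
    assume nt: "a \<notin> tradable I own i S"
    define X where "X = (\<Union>j\<in>{j. (i, j) \<in> ?T\<^sup>+}. own j)"
    have "tight own X"
      unfolding tight_def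
    proof
      fix x assume "x \<in> X"
      then obtain j where j: "(i, j) \<in> ?T\<^sup>+" "x \<in> own j" by (auto simp: X_def)
      have ul: "\<not> labelled own j" using nt a j by (auto simp: tradable_def)
      have oj: "own j = {x}" using unlabelled_singleton[OF v ul j(2)] .
      have jT: "\<exists>h. (h, j) \<in> ?T" using j(1) by (meson tranclD2)
      have "cl own j \<subseteq> X"
      proof
        fix y assume y: "y \<in> cl own j"
        then obtain k where k: "k \<ge> 1" "own j \<inter> pref I j k \<noteq> {}" "y \<in> pref I j k"
          by (auto simp: cl_def)
        \<comment> \<open>Validity guarantees that every object of the class has an owner, so there
          is an edge to follow.\<close>
        from y v obtain m where m: "y \<in> own m" unfolding valid_state_def by blast
        then have mS: "m \<in> S" using v by (auto simp: valid_state_def)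
        show "y \<in> X"
        proof (cases "y = x")
          case True then show ?thesis using \<open>x \<in> X\<close> by simp
        next
          case False
          then have "own m \<inter> (pref I j k - own j) \<noteq> {}" using oj m k by blast
          then have "(j, m) \<in> ?T" using jT ul k mS by (meson trading_graph.step)
          then have "(i, m) \<in> ?T\<^sup>+" using j(1) by (meson trancl.trancl_into_trancl)
          then show ?thesis using m by (auto simp: X_def)
        qed
      qed
      then show "\<exists>j. own j = {x} \<and> cl own j \<subseteq> X" using oj by blast
    qed
    moreover have "a \<in> X"
    proof -
      have "q \<in> S" using a v by (auto simp: valid_state_def)
      then have "(i, q) \<in> ?T" using a by (intro trading_graph.start) auto
      then show ?thesis using a by (auto simp: X_def)
    qed
    ultimately show False using nd tight_subset_dead by blast
  qed
qed

text \<open>An unowned object is never dead, and an owned object of the class is tradable unless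
  dead. Hence \<open>pick\<close> searches for the first class with a free or a tradable object,
  which is what the mechanism decides by comparing \<open>j1\<close> and \<open>j2\<close>.\<close>

lemma pref_not_dead_iff:
  assumes v: "valid_state S own" and i: "i \<notin> S" "i \<in> agents I" and k: "k \<ge> 1"
  shows "\<not> pref I i k \<subseteq> dead own \<longleftrightarrow>
    (objects I - (\<Union>j. own j)) \<inter> pref I i k \<noteq> {} \<or> tradable I own i S \<inter> pref I i k \<noteq> {}"
proof -
  have acc: "pref I i k \<subseteq> acceptable I i" using k by (auto simp: acceptable_def)
  have obj: "pref I i k \<subseteq> objects I" using pref_subset i k by simp
  have "x \<notin> dead own \<longleftrightarrow> x \<in> objects I - (\<Union>j. own j) \<or> x \<in> tradable I own i S"
    if x: "x \<in> pref I i k" for x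
  proof (cases "\<exists>q. x \<in> own q")
    case True
    then show ?thesis using tradable_iff[OF v i(1)] acc x by blast
  next
    case False
    then have "x \<notin> dead own" by (metis deadE insertI1)
    then show ?thesis using False x obj by blast
  qed
  then show ?thesis by blast
qed

text \<open>Supplies the premise under which \<open>valid_path_rule\<close> gives a path. Agents
  before the end of a simple path are automatically unlabelled: labelled agents point to nobody, and
  \<open>i\<close> owns nothing.\<close>

lemma ex_trading_path:
  assumes v: "valid_state S own" and i: "i \<notin> S" and a: "a \<in> tradable I own i S"
  shows "\<exists>p. trading_path I own i a S p"
proof -
  let ?T = "trading_graph I own i {a} S"
  obtain l where l: "labelled own l" "(i, l) \<in> ?T\<^sup>+" using a by (auto simp: tradable_def)
  have ui: "\<not> labelled own i" using v i by (auto simp: valid_state_def labelled_def)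
  obtain p where p: "p \<noteq> []" "hd p = i" "last p = l" "distinct p"
    "successively (\<lambda>u v. (u, v) \<in> ?T) p"
    using rtrancl_simple_path[OF trancl_into_rtrancl[OF l(2)]] by blast
  have "length p \<noteq> 1" using p l ui by (cases p) auto
  then have "length p \<ge> 2" using p(1) by (cases p) (auto simp: Suc_le_eq)
  moreover have "\<not> labelled own j" if "j \<in> set (butlast p)" for j
    using successively_butlast_ex[OF p(5) that] ui trading_graph_stepD(1) by metis
  ultimately show ?thesis using p l by (auto simp: trading_path_def)
qed

end

section \<open>The evolution of a run\<close>

lemma disjoint_family_upd:
  assumes "disjoint_family f" "A \<inter> (\<Union>j. f j) = {}"
  shows "disjoint_family (f(x := A))"
  using assms unfolding disjoint_family_on_def by (auto simp: disjoint_iff)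

lemma UN_disjoint_family_upd:
  assumes "disjoint_family f"
  shows "(\<Union>j. (f(x := A)) j) = ((\<Union>j. f j) - f x) \<union> A"
  using assms unfolding disjoint_family_on_def by (auto split: if_splits)

context house_allocation
begin

section \<open>Trading along a path\<close>

lemma pointing_subset: "pointing_objects I own i a x y \<subseteq> own y"
  by (auto simp: pointing_objects_def)

text \<open>The first agent is arbitrary and edges are replaced by \<open>pointing_objects\<close>,
  so that the induction can drop the head of the path. The objects of the head are lost because
  nobody takes them over; in an actual trade the head is \<open>i\<close>, who owns nothing.\<close>

lemma trade_spec:
  assumes "2 \<le> length p" "distinct p" "disjoint_family own" "\<And>j. own j \<subseteq> objects I"
    and "successively (\<lambda>x y. pointing_objects I own i a x y \<noteq> {}) p"
    and "labelled own (last p)" "\<And>j. j \<in> set (butlast p) \<Longrightarrow> \<not> labelled own j"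
  shows "\<forall>j. j \<notin> set p \<longrightarrow> trade I r own i a p j = own j"
    and "disjoint_family (trade I r own i a p)"
    and "(\<Union>j. trade I r own i a p j) = (\<Union>j. own j) - own (hd p)"
    and "\<forall>x\<in>set (butlast p). trade I r own i a p x \<noteq> {} \<and>
           (\<exists>y. trade I r own i a p x \<subseteq> pointing_objects I own i a x y)"
    and "trade I r own i a p (last p) \<subseteq> own (last p) \<and> trade I r own i a p (last p) \<noteq> {}"
proof -
  let ?po = "pointing_objects I own i a"
  let ?T = "trade I r own i a"
  have fin: "finite (own j)" for j using assms(4) finite_objects finite_subset by blast
  have "(\<forall>j. j \<notin> set p \<longrightarrow> ?T p j = own j) \<and> disjoint_family (?T p) \<and>
     (\<Union>j. ?T p j) = (\<Union>j. own j) - own (hd p) \<and>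
     (\<forall>x\<in>set (butlast p). ?T p x \<noteq> {} \<and> (\<exists>y. ?T p x \<subseteq> ?po x y)) \<and>
     ?T p (last p) \<subseteq> own (last p) \<and> ?T p (last p) \<noteq> {}"
    using assms(1,2,5,6,7)
  proof (induction p rule: induct_list012)
    case (3 x y zs)
    have xy: "x \<noteq> y" "?po x y \<noteq> {}" using 3 by auto
    have oxy: "own x \<inter> own y = {}" using xy assms(3) unfolding disjoint_family_on_def by simp
    show ?case
    proof (cases zs)
      case Nil
      define b where "b = highest r (?po x y)"
      have b: "b \<in> ?po x y" unfolding b_def
        using pointing_subset[of own i a x y] xy assms(4)[of y] finite_subset[OF _ fin[of y]]
        by (intro highest_mem[OF lin]) auto
      then have by': "b \<in> own y" using pointing_subset by blast
      \<comment> \<open>Taking \<open>b\<close> from \<open>y\<close> first makes it unowned, so it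
        can be given to \<open>x\<close> without breaking disjointness.\<close>
      have ey: "?T (x # y # zs) = (own(y := own y - {b}))(x := {b})"
        using Nil xy by (auto simp: b_def Let_def fun_upd_twist)
      have d1: "disjoint_family (own(y := own y - {b}))"
        using assms(3) unfolding disjoint_family_on_def by auto
      have U1: "(\<Union>j. (own(y := own y - {b})) j) = (\<Union>j. own j) - {b}"
        unfolding UN_disjoint_family_upd[OF assms(3)] using by' by blast
      have d2: "disjoint_family (?T (x # y # zs))"
        unfolding ey by (rule disjoint_family_upd[OF d1]) (use U1 in auto)
      have U2: "(\<Union>j. ?T (x # y # zs) j) = (\<Union>j. own j) - own x"
        unfolding ey UN_disjoint_family_upd[OF d1] U1
        using by' oxy xy by auto
      have "card (own y) > 1" using 3 Nil by (simp add: labelled_def)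
      then have "own y - {b} \<noteq> {}"
        using card_mono[of "{b}" "own y"] by auto
      then have "?T (x # y # zs) x = {b}" "?T (x # y # zs) y = own y - {b}" "own y - {b} \<noteq> {}"
        "\<forall>j. j \<notin> {x, y} \<longrightarrow> ?T (x # y # zs) j = own j"
        unfolding ey using xy by auto
      then show ?thesis using d2 U2 b by (auto simp: Nil simp del: trade.simps)
    next
      case (Cons z zs')
      let ?p = "y # zs"
      have IH: "\<forall>j. j \<notin> set ?p \<longrightarrow> ?T ?p j = own j" "disjoint_family (?T ?p)"
        "(\<Union>j. ?T ?p j) = (\<Union>j. own j) - own y"
        "\<forall>x\<in>set (butlast ?p). ?T ?p x \<noteq> {} \<and> (\<exists>y. ?T ?p x \<subseteq> ?po x y)"
        "?T ?p (last ?p) \<subseteq> own (last ?p) \<and> ?T ?p (last ?p) \<noteq> {}"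
        using "3.IH"(2) "3.prems" Cons by auto
      have ey: "?T (x # y # zs) = (?T ?p)(x := own y)" using Cons by simp
      have xn: "x \<notin> set ?p" using 3 by simp
      then have Tx: "?T ?p x = own x" using IH by blast
      \<comment> \<open>The trade along the tail has released the objects of \<open>y\<close>, so
        \<open>x\<close> may receive them.\<close>
      have d2: "disjoint_family (?T (x # y # zs))"
        unfolding ey by (rule disjoint_family_upd[OF IH(2)]) (use IH in auto)
      have U2: "(\<Union>j. ?T (x # y # zs) j) = (\<Union>j. own j) - own x"
        unfolding ey UN_disjoint_family_upd[OF IH(2)] IH(3) Tx
        using oxy by blast
      \<comment> \<open>As an interior agent \<open>y\<close> owns a single object, so
        \<open>own y\<close> is just the object because of which \<open>x\<close> points to
        him.\<close>
      have "\<not> labelled own y" using 3 Cons by auto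
      then have c1: "card (own y) \<le> Suc 0" by (simp add: labelled_def)
      obtain b where b: "b \<in> ?po x y" using xy(2) by blast
      then have "b \<in> own y" using pointing_subset by blast
      with c1 have "own y = {b}" using fin[of y] by (auto simp: card_le_Suc0_iff_eq)
      then have oy: "own y \<noteq> {} \<and> own y \<subseteq> ?po x y" using b by simp
      have last: "last ?p \<noteq> x" using xn by (metis last_in_set list.discI)
      have "\<forall>j. j \<notin> set (x # ?p) \<longrightarrow> ?T (x # ?p) j = own j" unfolding ey using IH(1) by auto
      moreover have "?T (x # ?p) u \<noteq> {} \<and> (\<exists>y. ?T (x # ?p) u \<subseteq> ?po u y)"
        if "u \<in> set (butlast (x # ?p))" for u
      proof (cases "u = x")
        case True
        then show ?thesis unfolding ey using oy by auto
      next
        case False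
        then have "u \<in> set (butlast ?p)" using that by simp
        then show ?thesis unfolding ey fun_upd_other[OF False] using IH(4) by blast
      qed
      moreover have "?T (x # ?p) (last (x # ?p)) \<subseteq> own (last (x # ?p)) \<and>
          ?T (x # ?p) (last (x # ?p)) \<noteq> {}"
        using IH(5) unfolding ey last_ConsR[OF list.distinct(2)] fun_upd_other[OF last] .
      ultimately show ?thesis using d2 U2 unfolding list.sel(1) by blast
    qed
  qed auto
  then show "\<forall>j. j \<notin> set p \<longrightarrow> trade I r own i a p j = own j"
    and "disjoint_family (trade I r own i a p)"
    and "(\<Union>j. trade I r own i a p j) = (\<Union>j. own j) - own (hd p)"
    and "\<forall>x\<in>set (butlast p). trade I r own i a p x \<noteq> {} \<and>
           (\<exists>y. trade I r own i a p x \<subseteq> pointing_objects I own i a x y)"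
    and "trade I r own i a p (last p) \<subseteq> own (last p) \<and> trade I r own i a p (last p) \<noteq> {}"
    by blast+
qed

section \<open>The effect of one processing step\<close>

lemma pick_cases:
  obtains "pick i D = {}" | k where "k \<ge> 1" "pick i D = pref I i k" "\<not> pref I i k \<subseteq> D"
proof (cases "\<exists>k\<ge>1. \<not> pref I i k \<subseteq> D")
  case True
  then have "(LEAST k. k \<ge> 1 \<and> \<not> pref I i k \<subseteq> D) \<ge> 1 \<and>
    \<not> pref I i (LEAST k. k \<ge> 1 \<and> \<not> pref I i k \<subseteq> D) \<subseteq> D" by (rule LeastI_ex)
  then show ?thesis using that(2) True by (auto simp: pick_def)
next
  case False
  then have "pick i D = {}" unfolding pick_def by (rule if_not_P)
  then show ?thesis using that(1) by blast
qed

lemma pick_eqI: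
  assumes "k \<ge> 1" "\<not> pref I i k \<subseteq> D" "\<And>l. l \<ge> 1 \<Longrightarrow> \<not> pref I i l \<subseteq> D \<Longrightarrow> k \<le> l"
  shows "pick i D = pref I i k"
proof -
  have "(LEAST k. k \<ge> 1 \<and> \<not> pref I i k \<subseteq> D) = k" by (rule Least_equality) (use assms in auto)
  then show ?thesis using assms by (auto simp: pick_def)
qed

lemma pick_nonempty:
  assumes "a \<in> acceptable I i" "a \<notin> D" shows "pick i D \<noteq> {}"
proof -
  obtain l where "l \<ge> 1" "a \<in> pref I i l" using assms by (auto simp: acceptable_def)
  then have ex: "\<exists>k\<ge>1. \<not> pref I i k \<subseteq> D" using assms by blast
  then have "\<not> pref I i (LEAST k. k \<ge> 1 \<and> \<not> pref I i k \<subseteq> D) \<subseteq> D"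
    by (rule LeastI2_ex) auto
  then show ?thesis using ex by (auto simp: pick_def)
qed

text \<open>Common core of both kinds of step. No object is released and every earlier owner stays
  inside his class with at least one object, so the old classes persist; the new agent owns inside
  \<open>pick i D\<close>, all of which is now allocated.\<close>

lemma extend_state:
  assumes v: "valid_state S own" and i: "i \<notin> S" "i \<in> agents I"
    and d: "disjoint_family own'" and U: "(\<Union>j. own j) \<subseteq> (\<Union>j. own' j)"
    and e: "\<And>j. j \<noteq> i \<Longrightarrow> own j = {} \<Longrightarrow> own' j = {}"
    and ne: "\<And>j. j \<noteq> i \<Longrightarrow> own j \<noteq> {} \<Longrightarrow> own' j \<noteq> {} \<and> own' j \<subseteq> cl own j"
    and p: "own' i \<subseteq> pick i D" "pick i D \<noteq> {} \<Longrightarrow> own' i \<noteq> {}" "pick i D \<subseteq> (\<Union>j. own' j)"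
  shows "valid_state (insert i S) own'" "cl own' i = pick i D"
    "\<forall>j. j \<noteq> i \<longrightarrow> cl own' j = cl own j"
proof -
  have A: "(\<exists>k\<ge>1. own' j \<subseteq> pref I j k) \<and> cl own' j = cl own j" if j: "j \<noteq> i" for j
  proof (cases "own j = {}")
    case True then show ?thesis using e[OF j True] by (auto simp: cl_empty)
  next
    case False
    then have ja: "j \<in> agents I" using v by (auto simp: valid_state_def)
    obtain k where k: "k \<ge> 1" "own j \<subseteq> pref I j k" using v unfolding valid_state_def by blast
    then have c: "cl own j = pref I j k" using valid_cl[OF v, of j k] False by blast
    then have "own' j \<subseteq> pref I j k" "own' j \<inter> pref I j k \<noteq> {}" using ne[OF j False] by auto
    then show ?thesis using cl_eq[OF ja k(1)] c k by metis
  qed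
  have B: "(\<exists>k\<ge>1. own' i \<subseteq> pref I i k) \<and> cl own' i = pick i D"
  proof (cases rule: pick_cases[of i D])
    case 1 then show ?thesis using p cl_empty by auto
  next
    case (2 k)
    then have "own' i \<inter> pref I i k \<noteq> {}" using p(1,2) by auto
    then show ?thesis using cl_eq[OF i(2) 2(1) _ _ 2(1)] 2 p by metis
  qed
  show "cl own' i = pick i D" "\<forall>j. j \<noteq> i \<longrightarrow> cl own' j = cl own j" using A B by auto
  have "cl own' j \<subseteq> (\<Union>j. own' j)" for j
  proof (cases "j = i")
    case False
    have "cl own j \<subseteq> (\<Union>j. own j)" using v by (auto simp: valid_state_def)
    then show ?thesis using A[OF False] U by auto
  qed (use B p in auto)
  moreover have "own' j = {}" if "j \<notin> insert i S" for j
    using that e v by (auto simp: valid_state_def)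
  moreover have "\<exists>k\<ge>1. own' j \<subseteq> pref I j k" for j using A B by (cases "j = i") auto
  ultimately show "valid_state (insert i S) own'"
    using v i d unfolding valid_state_def by blast
qed

text \<open>Classes are disjoint, so the description denotes the index of the best class meeting
  \<open>tradable\<close>. The bound on \<open>l\<close> keeps it apart from the default index
  \<open>num_objects I + 1\<close>.\<close>

lemma max_TG_Some:
  assumes i: "i \<in> agents I" and H: "tradable I own i S \<noteq> {}"
  obtains a l where "max_TG I r own i S = Some a" "l \<ge> 1" "a \<in> tradable I own i S" "a \<in> pref I i l"
    "(THE j. j \<ge> 1 \<and> a \<in> pref I i j) = l" "l \<le> num_objects I"
    "\<And>k. k \<ge> 1 \<Longrightarrow> tradable I own i S \<inter> pref I i k \<noteq> {} \<Longrightarrow> l \<le> k"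
proof -
  let ?H = "tradable I own i S"
  define l where "l = (LEAST l. l \<ge> 1 \<and> ?H \<inter> pref I i l \<noteq> {})"
  define a where "a = highest r (?H \<inter> pref I i l)"
  have "\<exists>l. l \<ge> 1 \<and> ?H \<inter> pref I i l \<noteq> {}"
    using H by (force simp: tradable_def acceptable_def)
  then have l: "l \<ge> 1 \<and> ?H \<inter> pref I i l \<noteq> {}" unfolding l_def by (rule LeastI_ex)
  have "a \<in> ?H \<inter> pref I i l" unfolding a_def
    using pref_subset[OF i, of l] l finite_objects
    by (intro highest_mem[OF lin]) (auto intro: finite_subset)
  moreover have "max_TG I r own i S = Some a"
    using H by (simp add: max_TG_def Let_def a_def l_def)
  moreover have "(THE j. j \<ge> 1 \<and> a \<in> pref I i j) = l"
    using \<open>a \<in> _\<close> l i pref_unique by (intro the_equality) auto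
  moreover have "l \<le> num_objects I" using pref_empty[OF i, of l] l by (cases "l \<le> num_objects I") auto
  moreover have "l \<le> k" if "k \<ge> 1" "?H \<inter> pref I i k \<noteq> {}" for k
    unfolding l_def using that by (intro Least_le) auto
  ultimately show ?thesis using that[of a l] l by auto
qed

text \<open>\<open>j1\<close> and \<open>j2\<close> are the first classes with a free and with a
  tradable object, so by \<open>pref_not_dead_iff\<close> the smaller one is the class found by
  \<open>pick\<close>. The alternatives are an agent left without objects, an allocation of free
  objects, and a trade.\<close>

lemma step_cases:
  fixes own ps i
  defines "Oi \<equiv> objects I - (\<Union>j. own j)" and "own' \<equiv> sdmt2_step I r P ps own i"
  assumes v: "valid_state (set ps) own" and i: "i \<notin> set ps" "i \<in> agents I"
  shows "pick i (dead own) = {} \<and> own' = own(i := {}) \<or>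
    Oi \<inter> pick i (dead own) \<noteq> {} \<and> own' = own(i := Oi \<inter> pick i (dead own)) \<or>
    (\<exists>a p. Oi \<inter> pick i (dead own) = {} \<and> a \<in> pick i (dead own) \<and>
       trading_path I own i a (set ps) p \<and> own' = trade I r own i a p)"
proof -
  let ?H = "tradable I own i (set ps)"
  define m where "m = max_TG I r own i (set ps)"
  define j1 where "j1 = (if \<exists>j\<ge>1. Oi \<inter> pref I i j \<noteq> {} then LEAST j. j \<ge> 1 \<and> Oi \<inter> pref I i j \<noteq> {}
                else num_objects I + 1)"
  define j2 where "j2 = (case m of None \<Rightarrow> num_objects I + 1 | Some a \<Rightarrow> THE j. j \<ge> 1 \<and> a \<in> pref I i j)"
  have own': "own' = (if j1 \<le> j2 then own(i := Oi \<inter> pref I i j1)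
         else trade I r own i (the m) (P ps own i (the m)))"
    unfolding own'_def sdmt2_step_def Let_def Oi_def j1_def j2_def m_def by simp
  have nd: "\<not> pref I i k \<subseteq> dead own \<longleftrightarrow> Oi \<inter> pref I i k \<noteq> {} \<or> ?H \<inter> pref I i k \<noteq> {}"
    if "k \<ge> 1" for k
    using pref_not_dead_iff[OF v i that] unfolding Oi_def .
  have j1_le: "j1 \<le> k" if "k \<ge> 1" "Oi \<inter> pref I i k \<noteq> {}" for k
  proof -
    have "(LEAST j. j \<ge> 1 \<and> Oi \<inter> pref I i j \<noteq> {}) \<le> k" using that by (intro Least_le) auto
    then show ?thesis using that unfolding j1_def by auto
  qed
  have j1_ex: "j1 \<ge> 1 \<and> Oi \<inter> pref I i j1 \<noteq> {}" if "\<exists>j\<ge>1. Oi \<inter> pref I i j \<noteq> {}"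
    using LeastI_ex[OF that] that unfolding j1_def by presburger
  have j2_le: "j2 \<le> k" if "k \<ge> 1" "?H \<inter> pref I i k \<noteq> {}" for k
  proof -
    have "?H \<noteq> {}" using that by auto
    from this show ?thesis
      by (rule max_TG_Some[OF i(2)]) (use that in \<open>auto simp: j2_def m_def\<close>)
  qed
  show ?thesis
  proof (cases "j1 \<le> j2")
    case True
    show ?thesis
    proof (cases "\<exists>j\<ge>1. Oi \<inter> pref I i j \<noteq> {}")
      case ex: True
      have "pick i (dead own) = pref I i j1"
      proof (rule pick_eqI)
        show "j1 \<ge> 1" "\<not> pref I i j1 \<subseteq> dead own" using j1_ex[OF ex] nd by auto
        show "j1 \<le> l" if "l \<ge> 1" "\<not> pref I i l \<subseteq> dead own" for l
          using that nd[of l] j1_le[of l] j2_le[of l] True by linarith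
      qed
      then show ?thesis using own' True j1_ex[OF ex] by simp
    next
      case nex: False
      then have j1: "j1 = num_objects I + 1" by (simp only: j1_def if_False)
      have H: "?H = {}"
      proof (rule ccontr)
        assume "?H \<noteq> {}"
        then have "j2 \<le> num_objects I"
          by (rule max_TG_Some[OF i(2)]) (auto simp: j2_def m_def)
        then show False using True j1 by simp
      qed
      have "pick i (dead own) = {}"
        using nd nex H by (auto simp: pick_def)
      \<comment> \<open>Here \<open>j1\<close> is the default index, whose class is empty, so the
        step allocates the empty set.\<close>
      moreover have "pref I i j1 = {}" using pref_empty i j1 by simp
      ultimately show ?thesis using own' True by simp
    qed
  next
    case False
    \<comment> \<open>The default value of \<open>j2\<close> is thus at least \<open>j1\<close>, so
      a trade happens only if \<open>max_TG\<close> yields an object.\<close>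
    have "j1 \<le> num_objects I + 1"
    proof (cases "\<exists>j\<ge>1. Oi \<inter> pref I i j \<noteq> {}")
      case True
      then show ?thesis using j1_ex[OF True] pref_empty[OF i(2), of j1]
        by (cases "j1 \<le> num_objects I + 1") auto
    qed (simp only: j1_def if_False le_refl)
    then have "m \<noteq> None" using False by (cases m) (auto simp: j2_def)
    then have H: "?H \<noteq> {}" by (auto simp: m_def max_TG_def Let_def)
    obtain a where a: "m = Some a" "j2 \<ge> 1" "a \<in> ?H" "a \<in> pref I i j2"
      by (rule max_TG_Some[OF i(2) H]) (auto simp: m_def j2_def)
    have pk: "pick i (dead own) = pref I i j2"
    proof (rule pick_eqI)
      show "j2 \<ge> 1" "\<not> pref I i j2 \<subseteq> dead own" using a nd by auto
      show "j2 \<le> l" if "l \<ge> 1" "\<not> pref I i l \<subseteq> dead own" for l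
        using that nd[of l] j1_le[of l] j2_le[of l] False by linarith
    qed
    have "Oi \<inter> pref I i j2 = {}" using j1_le[of j2] a False by auto
    moreover have "trading_path I own i a (set ps) (P ps own i a)"
      using ex_trading_path[OF v i(1) a(3)] path_rule unfolding valid_path_rule_def by blast
    moreover have "own' = trade I r own i a (P ps own i a)" using own' False a by simp
    ultimately show ?thesis using pk a(4) by blast
  qed
qed

text \<open>Each alternative of \<open>step_cases\<close> meets the premises of
  \<open>extend_state\<close>. Dead objects stay with their owners because every agent on a trading
  path reaches its labelled end, which the owner of a dead object cannot.\<close>

lemma step_spec:
  fixes own ps i
  defines "own' \<equiv> sdmt2_step I r P ps own i"
  assumes v: "valid_state (set ps) own" and i: "i \<notin> set ps" "i \<in> agents I"
  shows "valid_state (insert i (set ps)) own'" "cl own' i = pick i (dead own)"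
    "\<forall>j. j \<noteq> i \<longrightarrow> cl own' j = cl own j"
    "\<And>x j. x \<in> dead own \<Longrightarrow> own j = {x} \<Longrightarrow> own' j = {x}"
proof -
  let ?D = "dead own"
  let ?Oi = "objects I - (\<Union>j. own j)"
  have oi: "own i = {}" using v i by (simp add: valid_state_def)
  have dis: "disjoint_family own" using v by (simp add: valid_state_def)
  have ocl: "own j \<subseteq> cl own j" for j using valid_own_subset_cl[OF v] .
  have pobj: "pick i ?D \<subseteq> objects I"
    using pref_subset[OF i(2)] by (cases rule: pick_cases[of i ?D]) auto
  have "(valid_state (insert i (set ps)) own' \<and> cl own' i = pick i ?D \<and>
    (\<forall>j. j \<noteq> i \<longrightarrow> cl own' j = cl own j)) \<and>
    (\<forall>x j. x \<in> dead own \<longrightarrow> own j = {x} \<longrightarrow> own' j = {x})"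
    using step_cases[OF v i]
  proof (elim disjE exE conjE, fold own'_def)
    assume pk: "pick i ?D = {}" and o: "own' = own(i := {})"
    have "own' = own" using o oi fun_upd_triv[of own i] by simp
    then show ?thesis using extend_state[OF v i, of own' ?D] pk oi dis ocl by auto
  next
    assume ne: "?Oi \<inter> pick i ?D \<noteq> {}" and o: "own' = own(i := ?Oi \<inter> pick i ?D)"
    have d: "disjoint_family own'" unfolding o by (rule disjoint_family_upd[OF dis]) auto
    have U: "(\<Union>j. own' j) = (\<Union>j. own j) \<union> (?Oi \<inter> pick i ?D)"
      unfolding o UN_disjoint_family_upd[OF dis] oi by blast
    have "valid_state (insert i (set ps)) own' \<and> cl own' i = pick i ?D \<and>
      (\<forall>j. j \<noteq> i \<longrightarrow> cl own' j = cl own j)"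
      by (intro conjI extend_state[OF v i d, where D = ?D]; (simp only: U)?)
        (use o ne pobj ocl in auto)
    moreover have "own' j = {x}" if "own j = {x}" for j x using that oi o by auto
    ultimately show ?thesis by blast
  next
    fix a p
    assume ne: "?Oi \<inter> pick i ?D = {}" and a: "a \<in> pick i ?D"
      and tp: "trading_path I own i a (set ps) p" and o: "own' = trade I r own i a p"
    let ?T = "trading_graph I own i {a} (set ps)"
    have p: "2 \<le> length p" "hd p = i" "distinct p" "successively (\<lambda>x y. (x, y) \<in> ?T) p"
      "labelled own (last p)" "\<And>j. j \<in> set (butlast p) \<Longrightarrow> \<not> labelled own j"
      using tp by (auto simp: trading_path_def)
    have po: "pointing_objects I own i a x y \<noteq> {}" if "(x, y) \<in> ?T" for x y
      using that trading_graph_startD[OF _ i(1), of y I own "{a}"] trading_graph_stepD(2)[OF that]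
      by (cases "x = i") (force simp: pointing_objects_def)+
    have sp: "successively (\<lambda>x y. pointing_objects I own i a x y \<noteq> {}) p"
      using p(4) by (rule successively_mono) (use po in auto)
    note T = trade_spec[OF p(1,3) dis valid_own_objects[OF v] sp p(5,6), folded o]
    have U: "(\<Union>j. own' j) = (\<Union>j. own j)" using T(3) p(2) oi by simp
    have ib: "i \<in> set (butlast p)" using p(1,2) by (cases p rule: remdups_adj.cases) auto
    have il: "last p \<noteq> i" using p(5) oi by (auto simp: labelled_def)
    have setp: "set p = insert (last p) (set (butlast p))"
      using p(1) by (cases p rule: rev_cases) auto
    have oi': "own' i = {a}"
    proof -
      obtain y where "own' i \<noteq> {}" "own' i \<subseteq> pointing_objects I own i a i y" using T(4) ib by blast
      moreover have "pointing_objects I own i a i y \<subseteq> {a}" by (auto simp: pointing_objects_def)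
      ultimately show ?thesis by blast
    qed
    have j_ne: "own' j \<noteq> {} \<and> own' j \<subseteq> cl own j" if j: "j \<noteq> i" "own j \<noteq> {}" for j
    proof (cases "j \<in> set p")
      case False
      then show ?thesis using T(1) that ocl by auto
    next
      case True
      show ?thesis
      proof (cases "j = last p")
        case True then show ?thesis using T(5) ocl by blast
      next
        case False
        then have "j \<in> set (butlast p)" using True setp by auto
        then obtain y where y: "own' j \<noteq> {}" "own' j \<subseteq> pointing_objects I own i a j y"
          using T(4) by blast
        have "pointing_objects I own i a j y \<subseteq> cl own j"
          using j by (auto simp: pointing_objects_def cl_def)
        then show ?thesis using y by blast
      qed
    qed
    \<comment> \<open>An agent other than \<open>i\<close> without objects is neither labelled nor
      the source of an edge, so he is not on the path.\<close>
    have j_e: "own' j = {}" if j: "j \<noteq> i" "own j = {}" for j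
    proof -
      have "j \<notin> set p"
      proof
        assume "j \<in> set p"
        moreover have "j \<noteq> last p" using j p(5) by (auto simp: labelled_def)
        ultimately obtain z where "(j, z) \<in> ?T"
          using successively_butlast_ex[OF p(4)] setp by blast
        then show False using trading_graph_stepD(2)[OF _ j(1)] j(2) by blast
      qed
      then show ?thesis using T(1) j by simp
    qed
    have "valid_state (insert i (set ps)) own' \<and> cl own' i = pick i ?D \<and>
      (\<forall>j. j \<noteq> i \<longrightarrow> cl own' j = cl own j)"
      by (intro conjI extend_state[OF v i T(2), where D = ?D]; (simp only: U)?)
        (use j_ne j_e oi' a ne pobj in auto)
    moreover have "own' j = {x}" if x: "x \<in> dead own" "own j = {x}" for j x
    proof -
      have "j \<notin> set p"
      proof
        assume "j \<in> set p"
        then have "(j, last p) \<in> ?T\<^sup>*" using successively_reaches_last[OF p(4)] by blast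
        moreover have "j \<noteq> i" using x oi by auto
        ultimately have "own (last p) \<inter> dead own \<noteq> {}"
          using dead_reach[OF v i(1)] x by blast
        then show False using dead_unlabelled[OF v] p(5) by blast
      qed
      then show ?thesis using T(1) x by simp
    qed
    ultimately show ?thesis by blast
  qed
  then show "valid_state (insert i (set ps)) own'" "cl own' i = pick i (dead own)"
    "\<forall>j. j \<noteq> i \<longrightarrow> cl own' j = cl own j"
    "\<And>x j. x \<in> dead own \<Longrightarrow> own j = {x} \<Longrightarrow> own' j = {x}" by blast+
qed

text \<open>Owners of dead objects keep both object and class, so the old dead set is still
  tight.\<close>

lemma step_dead_mono:
  assumes v: "valid_state (set ps) own" and i: "i \<notin> set ps" "i \<in> agents I"
  shows "dead own \<subseteq> dead (sdmt2_step I r P ps own i)"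
proof (rule tight_subset_dead)
  have oi: "own i = {}" using v i by (simp add: valid_state_def)
  show "tight (sdmt2_step I r P ps own i) (dead own)"
    unfolding tight_def
  proof
    fix x assume x: "x \<in> dead own"
    then obtain j where j: "own j = {x}" "cl own j \<subseteq> dead own" by (rule deadE)
    then have "j \<noteq> i" using oi by auto
    then show "\<exists>j. sdmt2_step I r P ps own i j = {x} \<and> cl (sdmt2_step I r P ps own i) j \<subseteq> dead own"
      using step_spec(3,4)[OF v i] j x by metis
  qed
qed

section \<open>Runs and their prefixes\<close>

definition run :: "nat list \<Rightarrow> nat \<Rightarrow> 'o set" where
  "run xs = sdmt2_run I r P [] (\<lambda>_. {}) xs"

lemma sdmt2_run_append:
  "sdmt2_run I r P ps own (xs @ ys) = sdmt2_run I r P (ps @ xs) (sdmt2_run I r P ps own xs) ys"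
  by (induction xs arbitrary: ps own) auto

lemma run_Nil [simp]: "run [] = (\<lambda>_. {})"
  by (simp add: run_def)

lemma run_snoc: "run (xs @ [i]) = sdmt2_step I r P xs (run xs) i"
  by (simp add: run_def sdmt2_run_append)

lemma valid_run:
  assumes "distinct xs" "set xs \<subseteq> agents I"
  shows "valid_state (set xs) (run xs)"
  using assms
proof (induction xs rule: rev_induct)
  case Nil
  show ?case by (auto simp: valid_state_def disjoint_family_on_def cl_empty)
next
  case (snoc i xs)
  then show ?case using step_spec(1)[of xs "run xs" i] by (auto simp: run_snoc)
qed

lemma valid_cl_empty_iff: "valid_state S own \<Longrightarrow> cl own j = {} \<longleftrightarrow> own j = {}"
  using valid_own_subset_cl cl_empty by blast

lemma run_append:
  assumes "distinct (xs @ ys)" "set (xs @ ys) \<subseteq> agents I"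
  shows "dead (run xs) \<subseteq> dead (run (xs @ ys))"
    and "\<forall>j. j \<notin> set ys \<longrightarrow> cl (run (xs @ ys)) j = cl (run xs) j"
    and "\<forall>x j. x \<in> dead (run xs) \<longrightarrow> run xs j = {x} \<longrightarrow> run (xs @ ys) j = {x}"
proof -
  have "dead (run xs) \<subseteq> dead (run (xs @ ys)) \<and>
    (\<forall>j. j \<notin> set ys \<longrightarrow> cl (run (xs @ ys)) j = cl (run xs) j) \<and>
    (\<forall>x j. x \<in> dead (run xs) \<longrightarrow> run xs j = {x} \<longrightarrow> run (xs @ ys) j = {x})"
    using assms
  proof (induction ys rule: rev_induct)
    case (snoc i ys)
    have v: "valid_state (set (xs @ ys)) (run (xs @ ys))" using snoc by (intro valid_run) auto
    have i: "i \<notin> set (xs @ ys)" "i \<in> agents I" using snoc by auto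
    have e: "run (xs @ ys @ [i]) = sdmt2_step I r P (xs @ ys) (run (xs @ ys)) i"
      using run_snoc[of "xs @ ys" i] by simp
    have IH: "dead (run xs) \<subseteq> dead (run (xs @ ys))"
      "\<forall>j. j \<notin> set ys \<longrightarrow> cl (run (xs @ ys)) j = cl (run xs) j"
      "\<forall>x j. x \<in> dead (run xs) \<longrightarrow> run xs j = {x} \<longrightarrow> run (xs @ ys) j = {x}"
      using snoc by auto
    show ?case
      unfolding e using step_dead_mono[OF v i] step_spec(3,4)[OF v i] IH
      by (intro conjI) (blast, simp, blast)
  qed simp
  then show "dead (run xs) \<subseteq> dead (run (xs @ ys))"
    and "\<forall>j. j \<notin> set ys \<longrightarrow> cl (run (xs @ ys)) j = cl (run xs) j"
    and "\<forall>x j. x \<in> dead (run xs) \<longrightarrow> run xs j = {x} \<longrightarrow> run (xs @ ys) j = {x}"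
    by blast+
qed

text \<open>Counting: the objects dead in \<open>own\<close> but not in \<open>own'\<close> are as many as their owners in \<open>own\<close>,
  and in \<open>own'\<close> these agents hold disjoint nonempty sets of such objects, hence one each.\<close>

lemma dead_coupled:
  assumes v: "valid_state S own" and v': "valid_state S' own'"
    and c: "\<And>j. cl own j = cl own' j \<or> cl own j \<subseteq> dead own'"
  shows "dead own \<subseteq> dead own'"
proof -
  define Z where "Z = dead own - dead own'"
  \<comment> \<open>The selection is by class and not by owned object: a class that is not contained
    in \<open>dead own'\<close> must, by \<open>c\<close>, be the same in both states. Every owner
    in \<open>own\<close> of an object of \<open>Z\<close> qualifies.\<close>
  define R where "R = {j. \<exists>x\<in>dead own. own j = {x} \<and> cl own j \<subseteq> dead own \<and> \<not> cl own j \<subseteq> dead own'}"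
  have Zobj: "Z \<subseteq> objects I"
  proof
    fix x assume "x \<in> Z"
    then obtain j where "own j = {x}" unfolding Z_def by (metis deadE DiffD1)
    then show "x \<in> objects I" using valid_own_objects[OF v, of j] by simp
  qed
  then have finZ: "finite Z" using finite_objects finite_subset by blast
  have clR: "cl own' j = cl own j" if "j \<in> R" for j using that c[of j] by (auto simp: R_def)
  have RZ: "own' j \<subseteq> Z" "own' j \<noteq> {}" if j: "j \<in> R" for j
  proof -
    have "own' j \<inter> dead own' = {}"
    proof (rule ccontr)
      assume "own' j \<inter> dead own' \<noteq> {}"
      then obtain z where z: "z \<in> own' j" "z \<in> dead own'" by blast
      from z(2) obtain k where k: "own' k = {z}" "cl own' k \<subseteq> dead own'" by (rule deadE)
      then have "k = j" using valid_disjoint[OF v'] z by blast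
      then show False using j k clR by (auto simp: R_def)
    qed
    moreover have "own' j \<subseteq> dead own"
      using valid_own_subset_cl[OF v', of j] clR j by (auto simp: R_def)
    ultimately show "own' j \<subseteq> Z" by (auto simp: Z_def)
    show "own' j \<noteq> {}" using clR[OF j] j valid_cl_empty_iff[OF v'] by (auto simp: R_def)
  qed
  define g where "g j = (SOME x. x \<in> own' j)" for j
  have g: "g j \<in> own' j" if "j \<in> R" for j using RZ(2)[OF that] by (simp add: g_def some_in_eq)
  have ig: "inj_on g R" using g valid_disjoint[OF v'] by (metis inj_onI)
  have gZ: "g ` R \<subseteq> Z" using g RZ by blast
  define f where "f x = (SOME j. j \<in> R \<and> own j = {x})" for x
  have f: "f x \<in> R \<and> own (f x) = {x}" if x: "x \<in> Z" for x
  proof -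
    from x obtain j where j: "own j = {x}" "cl own j \<subseteq> dead own"
      unfolding Z_def by (metis deadE DiffD1)
    moreover have "x \<in> cl own j" using valid_own_subset_cl[OF v, of j] j by auto
    ultimately have "j \<in> R \<and> own j = {x}" using x by (auto simp: R_def Z_def)
    then show ?thesis unfolding f_def by (rule someI)
  qed
  have "inj_on f Z" using f by (metis inj_onI singleton_inject)
  moreover have finR: "finite R" using ig gZ finZ by (meson finite_imageD finite_subset)
  moreover have "f ` Z \<subseteq> R" using f by blast
  ultimately have "card Z \<le> card R" by (metis card_inj_on_le)
  then have gR: "g ` R = Z" using gZ finZ ig by (metis card_image card_seteq)
  have "tight own' (Z \<union> dead own')"
    unfolding tight_def
  proof
    fix x assume "x \<in> Z \<union> dead own'"
    then show "\<exists>j. own' j = {x} \<and> cl own' j \<subseteq> Z \<union> dead own'"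
    proof
      assume "x \<in> dead own'"
      then show ?thesis by (rule deadE) blast
    next
      assume "x \<in> Z"
      then obtain j where j: "j \<in> R" "x = g j" using gR by blast
      have "y = x" if "y \<in> own' j" for y
      proof -
        from that RZ j gR obtain j' where "j' \<in> R" "y = g j'" by blast
        then show ?thesis using g j that valid_disjoint[OF v'] by metis
      qed
      then have "own' j = {x}" using g j by blast
      moreover have "cl own' j \<subseteq> Z \<union> dead own'" using clR j by (auto simp: R_def Z_def)
      ultimately show ?thesis by blast
    qed
  qed
  then show ?thesis using tight_subset_dead unfolding Z_def by blast
qed

section \<open>Inserting an agent into the order, and agents who end up matched\<close>

text \<open>Induction over the later agents with the invariant that the class of each agent is the
  same in both runs or already dead in the run with \<open>i\<close>; \<open>dead_coupled\<close>
  turns the invariant into the inclusion.\<close>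

lemma run_insert_dead_mono:
  assumes "distinct (xs @ i # ys)" "set (xs @ i # ys) \<subseteq> agents I"
  shows "dead (run (xs @ ys)) \<subseteq> dead (run (xs @ i # ys))"
proof -
  have V: "valid_state (set (xs @ zs)) (run (xs @ zs))"
       "valid_state (set (xs @ i # zs)) (run (xs @ i # zs))"
    if "distinct (xs @ i # zs)" "set (xs @ i # zs) \<subseteq> agents I" for zs
    using that valid_run[of "xs @ zs"] valid_run[of "xs @ i # zs"] by auto
  have "\<forall>j. cl (run (xs @ ys)) j = cl (run (xs @ i # ys)) j \<or>
    cl (run (xs @ ys)) j \<subseteq> dead (run (xs @ i # ys))"
    using assms
  proof (induction ys rule: rev_induct)
    case Nil
    \<comment> \<open>The agent \<open>i\<close> satisfies the invariant trivially: in the run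
      without him he owns nothing.\<close>
    have "cl (run xs) i = {}" using V(1)[of "[]"] Nil by (auto intro!: cl_empty simp: valid_state_def)
    then show ?case using run_append(2)[of xs "[i]"] Nil by auto
  next
    case (snoc t ys)
    let ?A = "run (xs @ ys)" and ?B = "run (xs @ i # ys)"
    let ?A' = "run (xs @ ys @ [t])" and ?B' = "run (xs @ i # ys @ [t])"
    have IH: "\<And>j. cl ?A j = cl ?B j \<or> cl ?A j \<subseteq> dead ?B" using snoc by auto
    have vA: "valid_state (set (xs @ ys)) ?A" and vB: "valid_state (set (xs @ i # ys)) ?B"
      using V[of ys] snoc by auto
    have t: "t \<notin> set (xs @ ys)" "t \<notin> set (xs @ i # ys)" "t \<in> agents I" using snoc by auto
    have eA: "?A' = sdmt2_step I r P (xs @ ys) ?A t" using run_snoc[of "xs @ ys" t] by simp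
    have eB: "?B' = sdmt2_step I r P (xs @ i # ys) ?B t" using run_snoc[of "xs @ i # ys" t] by simp
    have dAB: "dead ?A \<subseteq> dead ?B" using dead_coupled[OF vA vB IH] .
    have dB: "dead ?B \<subseteq> dead ?B'" unfolding eB using step_dead_mono[OF vB t(2,3)] .
    show ?case
    proof
      fix j
      show "cl ?A' j = cl ?B' j \<or> cl ?A' j \<subseteq> dead ?B'"
      proof (cases "j = t")
        case False
        then have "cl ?A' j = cl ?A j" "cl ?B' j = cl ?B j"
          unfolding eA eB using step_spec(3)[OF vA t(1,3)] step_spec(3)[OF vB t(2,3)] by auto
        then show ?thesis using IH[of j] dB by auto
      next
        case True
        have pA: "cl ?A' t = pick t (dead ?A)" and pB: "cl ?B' t = pick t (dead ?B)"
          unfolding eA eB using step_spec(2)[OF vA t(1,3)] step_spec(2)[OF vB t(2,3)] by auto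
        \<comment> \<open>Since more objects are dead in \<open>?B\<close>, the search there either
          stops at the same class or finds that class entirely dead.\<close>
        have "pick t (dead ?A) = pick t (dead ?B) \<or> pick t (dead ?A) \<subseteq> dead ?B"
        proof (cases "\<exists>k\<ge>1. \<not> pref I t k \<subseteq> dead ?A")
          case ex: True
          define k where "k = (LEAST k. k \<ge> 1 \<and> \<not> pref I t k \<subseteq> dead ?A)"
          have k: "k \<ge> 1" "pick t (dead ?A) = pref I t k"
            using LeastI_ex[OF ex] ex by (auto simp: k_def pick_def)
          show ?thesis
          proof (cases "pref I t k \<subseteq> dead ?B")
            case False
            have "pick t (dead ?B) = pref I t k"
            proof (rule pick_eqI[OF k(1) False])
              fix l assume "l \<ge> 1" "\<not> pref I t l \<subseteq> dead ?B"
              then show "k \<le> l" using dAB unfolding k_def by (intro Least_le) auto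
            qed
            then show ?thesis using k by simp
          qed (use k in simp)
        qed (auto simp: pick_def)
        then show ?thesis using pA pB True dB by auto
      qed
    qed
  qed
  then show ?thesis using dead_coupled[OF V] assms by blast
qed

text \<open>On arrival \<open>i\<close> finds a class that is not entirely dead, later steps leave
  his class unchanged, and an agent without objects would have an empty one.\<close>

lemma run_matched:
  assumes d: "distinct (xs @ i # ys)" and s: "set (xs @ i # ys) \<subseteq> agents I"
    and a: "a \<in> acceptable I i" "a \<notin> dead (run xs)"
  shows "run (xs @ i # ys) i \<noteq> {}"
proof -
  have v: "valid_state (set xs) (run xs)" using d s by (intro valid_run) auto
  have i: "i \<notin> set xs" "i \<in> agents I" using d s by auto
  have "cl (run (xs @ [i])) i \<noteq> {}"
    unfolding run_snoc step_spec(2)[OF v i] using pick_nonempty a by blast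
  moreover have "cl (run ((xs @ [i]) @ ys)) i = cl (run (xs @ [i])) i"
    using run_append(2)[of "xs @ [i]" ys] d s by auto
  ultimately show ?thesis using cl_empty by auto
qed

end

section \<open>The primal-dual argument\<close>

lemma sort_key_eqI:
  assumes "\<And>x. x \<in> set xs \<Longrightarrow> f x = g x"
  shows "sort_key f xs = sort_key g xs"
proof -
  have ins: "insort_key f x ys = insort_key g x ys" if "\<And>y. y \<in> insert x (set ys) \<Longrightarrow> f y = g y" for x ys
    using that by (induction ys) auto
  show ?thesis
    using assms by (induction xs) (auto intro!: ins)
qed

text \<open>Insertion sort only compares measurable keys. There are countably many lists of
  naturals, so the sorted tail can be treated as a fixed list.\<close>

lemma measurable_sort_key:
  fixes f :: "'a \<Rightarrow> nat \<Rightarrow> real"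
  assumes "\<And>x. x \<in> set xs \<Longrightarrow> (\<lambda>Y. f Y x) \<in> borel_measurable M"
  shows "(\<lambda>Y. sort_key (f Y) xs) \<in> measurable M (count_space UNIV)"
proof -
  have ins: "(\<lambda>Y. insort_key (f Y) x ys) \<in> measurable M (count_space UNIV)"
    if "\<And>y. y \<in> insert x (set ys) \<Longrightarrow> (\<lambda>Y. f Y y) \<in> borel_measurable M" for x ys
    using that
  proof (induction ys)
    case (Cons y ys)
    have [measurable]: "(\<lambda>Y. f Y x) \<in> borel_measurable M" "(\<lambda>Y. f Y y) \<in> borel_measurable M"
      "(\<lambda>Y. insort_key (f Y) x ys) \<in> measurable M (count_space UNIV)"
      using Cons by auto
    show ?case by simp
  qed simp
  have "(\<lambda>Y. sort_key (f Y) zs) \<in> measurable M (count_space UNIV)"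
    if "set zs \<subseteq> set xs" for zs
    using that
  proof (induction zs)
    case (Cons z zs)
    have *: "(\<lambda>Y. sort_key (f Y) zs) \<in> measurable M (count_space UNIV)" using Cons by auto
    \<comment> \<open>Keys are known to be measurable only for members of \<open>xs\<close>, hence
      the guard; it holds for the sorted tail.\<close>
    define F where "F ys Y = (if set ys \<subseteq> set xs then insort_key (f Y) z ys else [])" for ys Y
    have F: "F ys \<in> measurable M (count_space UNIV)" for ys
    proof (cases "set ys \<subseteq> set xs")
      case True
      then have "(\<lambda>Y. insort_key (f Y) z ys) \<in> measurable M (count_space UNIV)"
        using Cons.prems assms by (intro ins) auto
      then show ?thesis using True by (simp add: F_def[abs_def])
    qed (simp add: F_def[abs_def])
    have "(\<lambda>Y. F (sort_key (f Y) zs) Y) \<in> measurable M (count_space UNIV)"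
      by (rule measurable_compose_countable[OF F *])
    moreover have "F (sort_key (f Y) zs) Y = sort_key (f Y) (z # zs)" for Y
      using Cons.prems by (simp add: F_def)
    ultimately show ?case by simp
  qed simp
  then show ?thesis by simp
qed

abbreviation unif :: "real measure" where
  "unif \<equiv> uniform_measure lborel {0..1}"

lemma prob_space_unif: "prob_space unif"
  by (rule prob_space_uniform_measure) auto

lemma AE_unif: "AE y in unif. y \<in> {0..1}"
  by (rule AE_uniform_measureI) auto

text \<open>The function \<open>w * exp (y - 1)\<close> is its own antiderivative, which gives the
  first summand. The point \<open>s\<close>, where nothing is assumed about \<open>G\<close>, is a
  null set.\<close>

lemma nn_integral_unif_threshold:
  assumes w: "w > 0" and s: "s \<in> {0..1}" and c: "c \<ge> 0"
    and G: "\<And>y. y \<in> {0..1} \<Longrightarrow> y \<noteq> s \<Longrightarrow> (if y < s then w * exp (y - 1) else 0) + c \<le> G y"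
  shows "ennreal (w * (exp (s - 1) - exp (- 1)) + c) \<le> (\<integral>\<^sup>+y. ennreal (G y) \<partial>unif)"
proof -
  let ?h = "\<lambda>y. ennreal (w * exp (y - 1)) * indicator {0..s} y + ennreal c"
  have es: "exp (- 1) \<le> exp (s - 1)" using s by simp
  have "(\<integral>\<^sup>+y. ennreal (w * exp (y - 1)) * indicator {0..s} y \<partial>lborel)
      = ennreal (w * exp (s - 1) - w * exp (0 - 1))"
    by (rule nn_integral_FTC_Icc) (use w s in \<open>auto intro!: derivative_eq_intros\<close>)
  then have FTC: "(\<integral>\<^sup>+y. ennreal (w * exp (y - 1)) * indicator {0..s} y \<partial>lborel)
      = ennreal (w * (exp (s - 1) - exp (- 1)))" by (simp add: right_diff_distrib)
  have "(\<integral>\<^sup>+y. ?h y \<partial>unif) = (\<integral>\<^sup>+y. ?h y * indicator {0..1} y \<partial>lborel)"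
    by (subst nn_integral_uniform_measure) (auto simp: divide_ennreal_def)
  also have "\<dots> = (\<integral>\<^sup>+y. ennreal (w * exp (y - 1)) * indicator {0..s} y
      + ennreal c * indicator {0..1} y \<partial>lborel)"
    by (rule nn_integral_cong) (use s in \<open>auto split: split_indicator\<close>)
  also have "\<dots> = ennreal (w * (exp (s - 1) - exp (- 1))) + ennreal c"
    by (subst nn_integral_add) (auto simp: FTC nn_integral_cmult_indicator)
  also have "\<dots> = ennreal (w * (exp (s - 1) - exp (- 1)) + c)"
    using w c es by (simp add: ennreal_plus)
  finally have "ennreal (w * (exp (s - 1) - exp (- 1)) + c) = (\<integral>\<^sup>+y. ?h y \<partial>unif)" by simp
  also have "\<dots> \<le> (\<integral>\<^sup>+y. ennreal (G y) \<partial>unif)"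
  proof (rule nn_integral_mono_AE)
    have "AE y in unif. y \<noteq> s"
      by (rule AE_uniform_measureI) (auto intro: AE_mp[OF AE_lborel_singleton[of s]])
    with AE_unif show "AE y in unif. ?h y \<le> ennreal (G y)"
    proof eventually_elim
      case (elim y)
      have "?h y = ennreal ((if y < s then w * exp (y - 1) else 0) + c)"
        using elim w c by (auto simp: ennreal_plus split: split_indicator)
      then show ?case using G[of y] elim by (auto intro!: ennreal_leI)
    qed
  qed
  finally show ?thesis .
qed

context house_allocation
begin

section \<open>The dual variables and their total\<close>

definition priority :: "(nat \<Rightarrow> real) \<Rightarrow> nat \<Rightarrow> real" where
  "priority Y i = weight I i * (1 - exp (Y i - 1))"

abbreviation outcome :: "(nat \<Rightarrow> real) \<Rightarrow> nat \<Rightarrow> 'o set" where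
  "outcome Y \<equiv> run (agent_order I Y)"

definition agent_dual :: "nat \<Rightarrow> (nat \<Rightarrow> real) \<Rightarrow> real" where
  "agent_dual i Y = (if outcome Y i \<noteq> {} then weight I i * exp (Y i - 1) else 0)"

text \<open>Ownership is disjoint, so at most one summand is nonzero, and the sum form avoids
  choosing an owner. An agent still owning several objects pays none of them.\<close>

definition object_dual :: "'o \<Rightarrow> (nat \<Rightarrow> real) \<Rightarrow> real" where
  "object_dual a Y = (\<Sum>j\<in>agents I. if outcome Y j = {a} then priority Y j else 0)"

lemma finite_agents: "finite (agents I)"
  by (simp add: agents_def)

lemma agent_order_conv: "agent_order I Y = sort_key (\<lambda>i. - priority Y i) [1..<num_agents I + 1]"
  by (simp add: agent_order_def priority_def)

lemma set_agent_order: "set (agent_order I Y) = agents I"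
  by (auto simp: agent_order_def agents_def)

lemma distinct_agent_order: "distinct (agent_order I Y)"
  by (simp add: agent_order_def)

lemma agent_order_split:
  assumes "agent_order I Y = xs @ ys" "x \<in> set xs" "y \<in> set ys"
  shows "priority Y y \<le> priority Y x"
proof -
  have "sorted (map (\<lambda>i. - priority Y i) (agent_order I Y))"
    unfolding agent_order_conv by (rule sorted_sort_key)
  then have "- priority Y x \<le> - priority Y y"
    using assms by (auto simp: sorted_append)
  then show ?thesis by simp
qed

text \<open>The keys of the other agents do not depend on the draw of \<open>i\<close>, and
  filtering commutes with stable sorting.\<close>

lemma agent_order_filter_upd:
  "filter (\<lambda>j. j \<noteq> i) (agent_order I (Y(i := y))) = filter (\<lambda>j. j \<noteq> i) (agent_order I Y)"
  unfolding agent_order_conv filter_sort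
  by (rule sort_key_eqI) (auto simp: priority_def)

lemma priority_nonneg:
  assumes "j \<in> agents I" "Y j \<in> {0..1}" shows "priority Y j \<ge> 0"
  using weight_pos[OF assms(1)] assms by (auto simp: priority_def)

lemma agent_dual_nonneg: "i \<in> agents I \<Longrightarrow> agent_dual i Y \<ge> 0"
  using weight_pos[of i] by (simp add: agent_dual_def)

lemma object_dual_nonneg:
  assumes "\<And>j. j \<in> agents I \<Longrightarrow> Y j \<in> {0..1}" shows "object_dual a Y \<ge> 0"
  unfolding object_dual_def using assms priority_nonneg by (intro sum_nonneg) auto

lemma matching_weight_sdmt2:
  "matching_weight I (random_sdmt2 I r P Y) = (\<Sum>i\<in>agents I. if outcome Y i \<noteq> {} then weight I i else 0)"
proof -
  have "Domain (random_sdmt2 I r P Y) = {i \<in> agents I. outcome Y i \<noteq> {}}"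
    by (auto simp: random_sdmt2_def sdmt2_def run_def Let_def set_agent_order)
  then show ?thesis
    by (simp add: matching_weight_def sum.inter_filter[OF finite_agents])
qed

text \<open>The two shares of a matched agent add up to his weight. \<open>M\<close> contains every
  agent and every object at most once, and an agent pays at most one object, so nothing is counted
  twice.\<close>

lemma sum_duals_le:
  assumes M: "is_matching I M" and Y: "\<And>j. j \<in> agents I \<Longrightarrow> Y j \<in> {0..1}"
  shows "(\<Sum>(i, a)\<in>M. agent_dual i Y + object_dual a Y) \<le> matching_weight I (random_sdmt2 I r P Y)"
proof -
  have inj: "inj_on fst M" "inj_on snd M" and sub: "fst ` M \<subseteq> agents I"
    using M by (auto simp: is_matching_def)
  have finM: "finite M" using inj(1) sub finite_agents by (meson finite_imageD finite_subset)
  have "(\<Sum>e\<in>M. agent_dual (fst e) Y) = (\<Sum>i\<in>fst ` M. agent_dual i Y)"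
    using inj by (simp add: sum.reindex)
  also have "\<dots> \<le> (\<Sum>i\<in>agents I. agent_dual i Y)"
    using sub finite_agents agent_dual_nonneg by (intro sum_mono2) auto
  finally have A: "(\<Sum>e\<in>M. agent_dual (fst e) Y) \<le> (\<Sum>i\<in>agents I. agent_dual i Y)" .
  have "(\<Sum>e\<in>M. object_dual (snd e) Y) = (\<Sum>a\<in>snd ` M. object_dual a Y)"
    using inj by (simp add: sum.reindex)
  also have "\<dots> = (\<Sum>j\<in>agents I. \<Sum>a\<in>snd ` M. if outcome Y j = {a} then priority Y j else 0)"
    unfolding object_dual_def by (rule sum.swap)
  also have "\<dots> \<le> (\<Sum>j\<in>agents I. if outcome Y j \<noteq> {} then priority Y j else 0)"
  proof (rule sum_mono)
    fix j assume j: "j \<in> agents I"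
    show "(\<Sum>a\<in>snd ` M. if outcome Y j = {a} then priority Y j else 0)
      \<le> (if outcome Y j \<noteq> {} then priority Y j else 0)"
    proof (cases "\<exists>b. outcome Y j = {b}")
      case True
      then obtain b where b: "outcome Y j = {b}" by blast
      then have "(\<Sum>a\<in>snd ` M. if outcome Y j = {a} then priority Y j else 0)
        = (if b \<in> snd ` M then priority Y j else 0)"
        using finM by (simp add: sum.delta')
      then show ?thesis using b priority_nonneg[of j Y] j Y[OF j] by auto
    next
      case False
      then show ?thesis using priority_nonneg[of j Y] j Y[OF j] by simp
    qed
  qed
  finally have B: "(\<Sum>e\<in>M. object_dual (snd e) Y)
    \<le> (\<Sum>j\<in>agents I. if outcome Y j \<noteq> {} then priority Y j else 0)" .
  have "(\<Sum>(i, a)\<in>M. agent_dual i Y + object_dual a Y)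
    = (\<Sum>e\<in>M. agent_dual (fst e) Y) + (\<Sum>e\<in>M. object_dual (snd e) Y)"
    by (simp add: case_prod_beta sum.distrib)
  also have "\<dots> \<le> (\<Sum>j\<in>agents I. agent_dual j Y + (if outcome Y j \<noteq> {} then priority Y j else 0))"
    using A B by (simp add: sum.distrib)
  also have "\<dots> = matching_weight I (random_sdmt2 I r P Y)"
    unfolding matching_weight_sdmt2 agent_dual_def priority_def
    by (intro sum.cong) (auto simp: algebra_simps)
  finally show ?thesis .
qed

text \<open>A dead object keeps its single owner, who was processed no later than the agent at whose
  arrival the object died.\<close>

lemma object_dual_ge:
  assumes Y: "\<And>j. j \<in> agents I \<Longrightarrow> Y j \<in> {0..1}"
    and L: "agent_order I Y = us @ t # vs" and a: "a \<in> dead (run (us @ [t]))"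
  shows "priority Y t \<le> object_dual a Y"
proof -
  have d: "distinct ((us @ [t]) @ vs)" "set ((us @ [t]) @ vs) \<subseteq> agents I"
    using distinct_agent_order[of Y] set_agent_order[of Y] L by auto
  obtain j where j: "run (us @ [t]) j = {a}" using a by (rule deadE)
  then have jo: "outcome Y j = {a}" using run_append(3)[OF d] a L by auto
  have "valid_state (set (us @ [t])) (run (us @ [t]))" using d by (intro valid_run) auto
  then have jm: "j \<in> set (us @ [t])" using j unfolding valid_state_def by blast
  then have ja: "j \<in> agents I" using d by auto
  have "priority Y t \<le> priority Y j"
    using agent_order_split[of Y us "t # vs" j t] L jm by auto
  also have "\<dots> = (\<Sum>k\<in>{j}. if outcome Y k = {a} then priority Y k else 0)" using jo by simp
  also have "\<dots> \<le> object_dual a Y"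
    unfolding object_dual_def using ja finite_agents priority_nonneg Y by (intro sum_mono2) auto
  finally show ?thesis .
qed

section \<open>The expected dual value of one edge\<close>

text \<open>The order without \<open>i\<close> does not depend on \<open>y\<close>. If
  \<open>a\<close> dies in it at the arrival of \<open>t\<close>, then \<open>c\<close> is the
  priority of \<open>t\<close>; if \<open>a\<close> never dies in it, \<open>i\<close> is always
  matched.\<close>

lemma death_threshold:
  assumes i: "i \<in> agents I" and a: "a \<in> acceptable I i"
    and Y: "\<forall>j\<in>agents I - {i}. Y j \<in> {0..1}"
  shows "(\<forall>y. outcome (Y(i := y)) i \<noteq> {}) \<or>
    (\<exists>c\<ge>0. \<forall>y\<in>{0..1}. c \<le> object_dual a (Y(i := y)) \<and>
       (c < priority (Y(i := y)) i \<longrightarrow> outcome (Y(i := y)) i \<noteq> {}))"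
proof -
  define zs where "zs = filter (\<lambda>j. j \<noteq> i) (agent_order I Y)"
  have dz: "distinct zs" "set zs = agents I - {i}"
    by (auto simp: zs_def distinct_agent_order set_agent_order)
  have split: "\<exists>xs ys. agent_order I (Y(i := y)) = xs @ i # ys \<and> zs = xs @ ys" for y
  proof -
    have "i \<in> set (agent_order I (Y(i := y)))" using i by (simp add: set_agent_order)
    then obtain xs ys where xy: "agent_order I (Y(i := y)) = xs @ i # ys" by (meson split_list)
    then have "i \<notin> set xs" "i \<notin> set ys" using distinct_agent_order[of "Y(i := y)"] by auto
    then have "filter (\<lambda>j. j \<noteq> i) xs = xs" "filter (\<lambda>j. j \<noteq> i) ys = ys"
      by (intro filter_True; blast)+
    then have "filter (\<lambda>j. j \<noteq> i) (xs @ i # ys) = xs @ ys" by simp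
    then have "zs = xs @ ys" using agent_order_filter_upd[of i Y y] xy by (simp only: zs_def)
    then show ?thesis using xy by blast
  qed
  have ok: "distinct (xs @ i # ys)" "set (xs @ i # ys) \<subseteq> agents I" if "zs = xs @ ys" for xs ys
    using dz that i by auto
  show ?thesis
  proof (cases "a \<in> dead (run zs)")
    case False
    have "outcome (Y(i := y)) i \<noteq> {}" for y
    proof -
      obtain xs ys where xy: "agent_order I (Y(i := y)) = xs @ i # ys" "zs = xs @ ys"
        using split by blast
      have "a \<notin> dead (run xs)" using run_append(1)[of xs ys] ok[OF xy(2)] False xy(2) by auto
      then show ?thesis unfolding xy(1) by (intro run_matched[OF ok[OF xy(2)] a])
    qed
    then show ?thesis by blast
  next
    case True
    have "\<exists>us t vs. zs' = us @ t # vs \<and> a \<notin> dead (run us) \<and> a \<in> dead (run (us @ [t]))"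
      if "a \<in> dead (run zs')" for zs'
      using that
    proof (induction zs' rule: rev_induct)
      case Nil
      then show ?case by (metis deadE run_Nil insert_not_empty)
    next
      case (snoc t us)
      then show ?case by (metis append.assoc append_Cons append_Nil)
    qed
    then obtain us t vs where ut: "zs = us @ t # vs" "a \<notin> dead (run us)" "a \<in> dead (run (us @ [t]))"
      using True by blast
    have t: "t \<in> agents I" "t \<noteq> i" using dz ut by auto
    have pt: "priority (Y(i := y)) t = priority Y t" for y using t by (simp add: priority_def)
    have "priority Y t \<le> object_dual a (Y(i := y)) \<and>
       (priority Y t < priority (Y(i := y)) i \<longrightarrow> outcome (Y(i := y)) i \<noteq> {})"
      if y: "y \<in> {0..1}" for y
    proof -
      have Yy: "(Y(i := y)) j \<in> {0..1}" if "j \<in> agents I" for j using Y y that by auto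
      obtain xs ys where xy: "agent_order I (Y(i := y)) = xs @ i # ys" "zs = xs @ ys"
        using split by blast
      note d = ok[OF xy(2)]
      from xy(2) ut(1) have "xs @ ys = us @ t # vs" by simp
      \<comment> \<open>If \<open>i\<close> arrives before \<open>t\<close>, then \<open>a\<close>
        is not yet dead and \<open>i\<close> is matched, while by monotonicity \<open>a\<close> is
        dead once \<open>t\<close> has been processed. If \<open>i\<close> arrives after
        \<open>t\<close>, the run up to \<open>t\<close> is unchanged and the priority of
        \<open>i\<close> is at most that of \<open>t\<close>.\<close>
      then consider (early) ws where "us = xs @ ws" "ys = ws @ t # vs"
        | (late) ws where "xs = us @ t # ws" "vs = ws @ ys"
        by (auto simp: append_eq_append_conv2 append_eq_Cons_conv Cons_eq_append_conv)
      then show ?thesis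
      proof cases
        case early
        have L: "agent_order I (Y(i := y)) = (xs @ i # ws) @ t # vs" using xy early by simp
        have "dead (run (xs @ (ws @ [t]))) \<subseteq> dead (run (xs @ i # (ws @ [t])))"
          using d early by (intro run_insert_dead_mono) auto
        then have "a \<in> dead (run ((xs @ i # ws) @ [t]))" using ut early by auto
        then have "priority Y t \<le> object_dual a (Y(i := y))"
          using object_dual_ge[OF Yy L] pt by simp
        moreover have "a \<notin> dead (run xs)"
          using run_append(1)[of xs ws] d early ut by (auto simp: Int_Un_distrib)
        then have "outcome (Y(i := y)) i \<noteq> {}" unfolding xy(1) by (intro run_matched[OF d a])
        ultimately show ?thesis by simp
      next
        case late
        have L: "agent_order I (Y(i := y)) = us @ t # (ws @ i # ys)" using xy late by simp
        have "priority Y t \<le> object_dual a (Y(i := y))"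
          using object_dual_ge[OF Yy L ut(3)] pt by simp
        moreover have "priority (Y(i := y)) i \<le> priority Y t"
          using agent_order_split[of "Y(i := y)" xs "i # ys" t i] xy late pt by auto
        ultimately show ?thesis by auto
      qed
    qed
    moreover have "priority Y t \<ge> 0" using priority_nonneg t Y by simp
    ultimately show ?thesis by blast
  qed
qed

text \<open>The agent \<open>i\<close> is matched for all draws below the point \<open>s\<close>
  where his priority falls to \<open>c\<close>, and \<open>a\<close> contributes at least
  \<open>c\<close> throughout. What a larger \<open>c\<close> takes from the integral of the first
  share it returns through the second.\<close>

lemma edge_bound:
  assumes i: "i \<in> agents I" and a: "a \<in> acceptable I i"
    and Y: "\<forall>j\<in>agents I - {i}. Y j \<in> {0..1}"
  shows "ennreal ((1 - 1 / exp 1) * weight I i) \<le>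
    (\<integral>\<^sup>+y. ennreal (agent_dual i (Y(i := y)) + object_dual a (Y(i := y))) \<partial>unif)"
    (is "_ \<le> integral\<^sup>N _ (\<lambda>y. ennreal (?G y))")
proof -
  define w where "w = weight I i"
  have w: "w > 0" using weight_pos i by (simp add: w_def)
  have Yy: "(Y(i := y)) j \<in> {0..1}" if "j \<in> agents I" "y \<in> {0..1}" for j y using Y that by auto
  have ob: "object_dual a (Y(i := y)) \<ge> 0" if "y \<in> {0..1}" for y
    using object_dual_nonneg Yy that by blast
  have ag: "agent_dual i (Y(i := y)) = w * exp (y - 1)" if "outcome (Y(i := y)) i \<noteq> {}" for y
    using that by (simp add: agent_dual_def w_def)
  have ag0: "agent_dual i (Y(i := y)) \<ge> 0" for y using agent_dual_nonneg i by blast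
  have thr: ?thesis
    if s: "s \<in> {0..1}" and c: "c \<ge> 0" "\<And>y. y \<in> {0..1} \<Longrightarrow> c \<le> object_dual a (Y(i := y))"
      and m: "\<And>y. y \<in> {0..1} \<Longrightarrow> y < s \<Longrightarrow> outcome (Y(i := y)) i \<noteq> {}"
      and b: "(1 - 1 / exp 1) * w \<le> w * (exp (s - 1) - exp (- 1)) + c" for s c
  proof -
    have "ennreal ((1 - 1 / exp 1) * w) \<le> ennreal (w * (exp (s - 1) - exp (- 1)) + c)"
      using b by (rule ennreal_leI)
    also have "\<dots> \<le> (\<integral>\<^sup>+y. ennreal (?G y) \<partial>unif)"
    proof (rule nn_integral_unif_threshold[OF w s c(1)])
      fix y :: real assume "y \<in> {0..1}" "y \<noteq> s"
      then show "(if y < s then w * exp (y - 1) else 0) + c \<le> ?G y"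
        using c(2)[of y] m[of y] ag[of y] ag0[of y] by auto
    qed
    finally show ?thesis by (simp add: w_def)
  qed
  have em: "exp (- 1 :: real) = 1 / exp 1" by (simp add: exp_minus field_simps)
  from death_threshold[OF i a Y] show ?thesis
  proof (elim disjE exE conjE)
    assume "\<forall>y. outcome (Y(i := y)) i \<noteq> {}"
    then show ?thesis by (intro thr[of 1 0]) (auto simp: ob em)
  next
    fix c assume c: "c \<ge> 0" and *: "\<forall>y\<in>{0..1}. c \<le> object_dual a (Y(i := y)) \<and>
       (c < priority (Y(i := y)) i \<longrightarrow> outcome (Y(i := y)) i \<noteq> {})"
    show ?thesis
    proof (cases "c \<ge> (1 - 1 / exp 1) * w")
      case True
      \<comment> \<open>The share of the object alone suffices, so the threshold may be
        \<open>0\<close>.\<close>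
      then show ?thesis using c * by (intro thr[of 0 c]) auto
    next
      case False
      \<comment> \<open>This solves \<open>w * (1 - exp (s - 1)) = c\<close>; the failed case
        condition gives \<open>s > 0\<close>. The required inequality then holds with
        equality.\<close>
      define s where "s = 1 + ln (1 - c / w)"
      have cw: "c / w < 1 - exp (- 1)" using False w by (simp add: em field_simps)
      have cw0: "c / w \<ge> 0" using c w by simp
      have es: "exp (s - 1) = 1 - c / w"
        using cw by (simp add: s_def) (metis diff_gt_0_iff_gt exp_gt_zero exp_ln less_diff_eq add.commute order_less_trans)
      have "exp (- 1) \<le> exp (s - 1)" "exp (s - 1) \<le> exp 0" using es cw cw0 by auto
      then have s: "s \<in> {0..1}" by simp
      show ?thesis
      proof (rule thr[OF s c])
        show "c \<le> object_dual a (Y(i := y))" if "y \<in> {0..1}" for y using * that by blast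
        show "outcome (Y(i := y)) i \<noteq> {}" if y: "y \<in> {0..1}" "y < s" for y
        proof -
          have "exp (y - 1) < exp (s - 1)" using y by simp
          then have "c < w * (1 - exp (y - 1))" using es w by (simp add: field_simps)
          then show ?thesis using * y by (simp add: priority_def w_def)
        qed
        show "(1 - 1 / exp 1) * w \<le> w * (exp (s - 1) - exp (- 1)) + c"
          unfolding es em using w by (simp add: field_simps)
      qed
    qed
  qed
qed

section \<open>Measurability and integrability of the duals\<close>

lemma sets_draws: "sets (draws I) = sets (\<Pi>\<^sub>M i\<in>agents I. borel)"
  unfolding draws_def by (intro sets_PiM_cong) auto

lemma measurable_draw: "i \<in> agents I \<Longrightarrow> (\<lambda>Y. Y i) \<in> borel_measurable (draws I)"
  using measurable_component_singleton[of i "agents I" "\<lambda>_. borel :: real measure"]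
  by (simp add: measurable_cong_sets[OF sets_draws refl])

lemma measurable_priority: "i \<in> agents I \<Longrightarrow> (\<lambda>Y. priority Y i) \<in> borel_measurable (draws I)"
  using measurable_draw[of i] unfolding priority_def by measurable

lemma measurable_agent_order: "agent_order I \<in> measurable (draws I) (count_space UNIV)"
  unfolding agent_order_conv[abs_def]
proof (rule measurable_sort_key)
  fix i assume "i \<in> set [1..<num_agents I + 1]"
  then have "i \<in> agents I" by (auto simp: agents_def)
  then show "(\<lambda>Y. - priority Y i) \<in> borel_measurable (draws I)"
    using measurable_priority by measurable
qed

text \<open>The outcome depends on the draws only through the order, which ranges over countably
  many lists; for a fixed list the condition is constant.\<close>

lemma measurable_outcome_dep:
  assumes "\<And>i. i \<in> agents I \<Longrightarrow> (\<lambda>Y. f Y i) \<in> borel_measurable (draws I)" "i \<in> agents I"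
  shows "(\<lambda>Y. if Q (outcome Y i) then f Y i else (0::real)) \<in> borel_measurable (draws I)"
proof -
  have "(\<lambda>Y. if Q (run l i) then f Y i else 0) \<in> borel_measurable (draws I)" for l
    using assms by (cases "Q (run l i)") auto
  from measurable_compose_countable[OF this measurable_agent_order] show ?thesis .
qed

lemma measurable_agent_dual: "i \<in> agents I \<Longrightarrow> agent_dual i \<in> borel_measurable (draws I)"
  unfolding agent_dual_def[abs_def]
proof (rule measurable_outcome_dep)
  show "(\<lambda>Y. weight I i * exp (Y i - 1)) \<in> borel_measurable (draws I)" if "i \<in> agents I" for i
    using measurable_draw[OF that] by measurable
qed

lemma measurable_object_dual: "object_dual a \<in> borel_measurable (draws I)"
  unfolding object_dual_def[abs_def]
  by (intro borel_measurable_sum measurable_outcome_dep measurable_priority)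

lemma measurable_matching_weight:
  "(\<lambda>Y. matching_weight I (random_sdmt2 I r P Y)) \<in> borel_measurable (draws I)"
  unfolding matching_weight_sdmt2
  by (intro borel_measurable_sum measurable_outcome_dep) auto

lemma prob_space_draws: "prob_space (draws I)"
  unfolding draws_def by (intro prob_space_PiM prob_space_unif)

lemma AE_draws: "AE Y in draws I. \<forall>j\<in>agents I. Y j \<in> {0..1}"
  unfolding draws_def using finite_agents
  by (intro eventually_ball_finite ballI AE_PiM_component prob_space_unif AE_unif) auto

lemma duals_le_weight:
  assumes i: "i \<in> agents I" and Y: "\<forall>j\<in>agents I. Y j \<in> {0..1}"
  shows "norm (agent_dual i Y + object_dual a Y) \<le> weight I i + (\<Sum>j\<in>agents I. weight I j)"
proof -
  have p: "priority Y j \<le> weight I j" if "j \<in> agents I" for j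
    using weight_pos[OF that] by (simp add: priority_def field_simps)
  have "agent_dual i Y \<le> weight I i"
    using weight_pos[OF i] Y i by (simp add: agent_dual_def mult_left_le)
  moreover have "object_dual a Y \<le> (\<Sum>j\<in>agents I. weight I j)"
    unfolding object_dual_def using p weight_pos by (intro sum_mono) (auto simp: less_imp_le)
  moreover have "agent_dual i Y \<ge> 0" "object_dual a Y \<ge> 0"
    using agent_dual_nonneg[OF i] object_dual_nonneg Y by auto
  ultimately show ?thesis by simp
qed

lemma integrable_duals:
  assumes i: "i \<in> agents I"
  shows "integrable (draws I) (\<lambda>Y. agent_dual i Y + object_dual a Y)"
proof -
  interpret prob_space "draws I" by (rule prob_space_draws)
  show ?thesis
  proof (rule integrable_const_bound)
    show "AE Y in draws I. norm (agent_dual i Y + object_dual a Y)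
        \<le> weight I i + (\<Sum>j\<in>agents I. weight I j)"
      using AE_draws by eventually_elim (rule duals_le_weight[OF i])
  qed (use measurable_agent_dual[OF i] measurable_object_dual in measurable)
qed

section \<open>Expectations and comparison with the optimum\<close>

text \<open>The product integral is split into the draw of \<open>i\<close> and the other draws, and
  \<open>edge_bound\<close> applies to the inner integral for almost all values of the
  others.\<close>

lemma expected_duals_ge:
  assumes i: "i \<in> agents I" and a: "a \<in> acceptable I i"
  shows "(1 - 1 / exp 1) * weight I i \<le> (\<integral>Y. agent_dual i Y + object_dual a Y \<partial>draws I)"
proof -
  define J where "J = agents I - {i}"
  have J: "finite J" "i \<notin> J" "insert i J = agents I" using i finite_agents by (auto simp: J_def)
  let ?f = "\<lambda>Y. agent_dual i Y + object_dual a Y"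
  interpret U: prob_space unif by (rule prob_space_unif)
  interpret product_sigma_finite "\<lambda>_::nat. unif" by standard
  interpret PJ: prob_space "Pi\<^sub>M J (\<lambda>_. unif)" by (intro prob_space_PiM prob_space_unif)
  have meas: "(\<lambda>Y. ennreal (?f Y)) \<in> borel_measurable (Pi\<^sub>M (insert i J) (\<lambda>_. unif))"
    using measurable_agent_dual[OF i] measurable_object_dual[of a]
    unfolding J draws_def by measurable
  have "ennreal ((1 - 1 / exp 1) * weight I i)
      = (\<integral>\<^sup>+x. ennreal ((1 - 1 / exp 1) * weight I i) \<partial>Pi\<^sub>M J (\<lambda>_. unif))"
    by (simp add: PJ.emeasure_space_1)
  also have "\<dots> \<le> (\<integral>\<^sup>+x. (\<integral>\<^sup>+y. ennreal (?f (x(i := y))) \<partial>unif) \<partial>Pi\<^sub>M J (\<lambda>_. unif))"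
  proof (rule nn_integral_mono_AE)
    have "AE x in Pi\<^sub>M J (\<lambda>_. unif). \<forall>j\<in>J. x j \<in> {0..1}"
      using J by (intro eventually_ball_finite ballI AE_PiM_component prob_space_unif AE_unif) auto
    then show "AE x in Pi\<^sub>M J (\<lambda>_. unif). ennreal ((1 - 1 / exp 1) * weight I i)
        \<le> (\<integral>\<^sup>+y. ennreal (?f (x(i := y))) \<partial>unif)"
      by eventually_elim (rule edge_bound[OF i a], simp add: J_def)
  qed
  also have "\<dots> = (\<integral>\<^sup>+Y. ennreal (?f Y) \<partial>draws I)"
    unfolding product_nn_integral_insert[OF J(1,2) meas, symmetric] J(3) draws_def ..
  also have "\<dots> = ennreal (\<integral>Y. ?f Y \<partial>draws I)"
  proof (rule nn_integral_eq_integral[OF integrable_duals[OF i]])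
    show "AE Y in draws I. 0 \<le> ?f Y"
      using AE_draws
      by eventually_elim (intro add_nonneg_nonneg agent_dual_nonneg i object_dual_nonneg, auto)
  qed
  finally have *: "ennreal ((1 - 1 / exp 1) * weight I i) \<le> ennreal (\<integral>Y. ?f Y \<partial>draws I)" .
  have "0 \<le> (\<integral>Y. ?f Y \<partial>draws I)"
  proof (rule integral_nonneg_AE)
    show "AE Y in draws I. 0 \<le> ?f Y"
      using AE_draws
      by eventually_elim (intro add_nonneg_nonneg agent_dual_nonneg i object_dual_nonneg, auto)
  qed
  with * show ?thesis by (simp add: ennreal_le_iff)
qed

lemma opt_weight_attained:
  obtains M where "is_matching I M" "opt_weight I = matching_weight I M"
proof -
  have acc: "acceptable I i \<subseteq> objects I" if "i \<in> agents I" for i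
    using pref_subset[OF that] by (auto simp: acceptable_def)
  have "{M. is_matching I M} \<subseteq> Pow (agents I \<times> objects I)"
    using acc by (auto simp: is_matching_def)
  then have fin: "finite {M. is_matching I M}"
    using finite_agents finite_objects by (meson finite_Pow_iff finite_SigmaI finite_subset)
  have "is_matching I {}" by (simp add: is_matching_def)
  then have "opt_weight I \<in> matching_weight I ` {M. is_matching I M}"
    unfolding opt_weight_def using fin by (intro Max_in) auto
  then show ?thesis using that by blast
qed

text \<open>The edge bounds are summed over an optimal matching by linearity of expectation, and
  \<open>sum_duals_le\<close> bounds the sum of duals for almost all draws.\<close>

lemma expected_weight_ge:
  "(1 - 1 / exp 1) * opt_weight I \<le> (\<integral>Y. matching_weight I (random_sdmt2 I r P Y) \<partial>draws I)"
proof -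
  obtain M where M: "is_matching I M" and opt: "opt_weight I = matching_weight I M"
    by (rule opt_weight_attained)
  have inj: "inj_on fst M" and sub: "M \<subseteq> Sigma (agents I) (acceptable I)"
    using M by (auto simp: is_matching_def)
  interpret prob_space "draws I" by (rule prob_space_draws)
  have "opt_weight I = (\<Sum>e\<in>M. weight I (fst e))"
    unfolding opt matching_weight_def using inj by (simp add: Domain_fst sum.reindex)
  then have "(1 - 1 / exp 1) * opt_weight I = (\<Sum>e\<in>M. (1 - 1 / exp 1) * weight I (fst e))"
    by (simp add: sum_distrib_left)
  also have "\<dots> \<le> (\<Sum>e\<in>M. \<integral>Y. agent_dual (fst e) Y + object_dual (snd e) Y \<partial>draws I)"
    using sub by (intro sum_mono expected_duals_ge) auto
  also have "\<dots> = (\<integral>Y. (\<Sum>e\<in>M. agent_dual (fst e) Y + object_dual (snd e) Y) \<partial>draws I)"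
    using sub by (intro Bochner_Integration.integral_sum[symmetric] integrable_duals) auto
  also have "\<dots> \<le> (\<integral>Y. matching_weight I (random_sdmt2 I r P Y) \<partial>draws I)"
  proof (rule integral_mono_AE)
    show "integrable (draws I) (\<lambda>Y. \<Sum>e\<in>M. agent_dual (fst e) Y + object_dual (snd e) Y)"
      using sub by (intro Bochner_Integration.integrable_sum integrable_duals) auto
    show "integrable (draws I) (\<lambda>Y. matching_weight I (random_sdmt2 I r P Y))"
    proof (rule integrable_const_bound)
      have "norm (matching_weight I (random_sdmt2 I r P Y)) \<le> (\<Sum>j\<in>agents I. weight I j)" for Y
        unfolding matching_weight_sdmt2 real_norm_def
        by (rule order_trans[OF sum_abs sum_mono]) (auto simp: weight_pos less_imp_le)
      then show "AE Y in draws I. norm (matching_weight I (random_sdmt2 I r P Y))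
          \<le> (\<Sum>j\<in>agents I. weight I j)" by simp
    qed (rule measurable_matching_weight)
    show "AE Y in draws I. (\<Sum>e\<in>M. agent_dual (fst e) Y + object_dual (snd e) Y)
        \<le> matching_weight I (random_sdmt2 I r P Y)"
      using AE_draws
    proof eventually_elim
      case (elim Y)
      then show ?case using sum_duals_le[OF M, of Y] by (simp add: case_prod_beta)
    qed
  qed
  finally show ?thesis .
qed

end

theorem theorem5p10:
  fixes I :: "'o ha" and r :: "'o rel" and P :: "'o path_rule"
  assumes "ha_instance I"
    and "strict_linear_order_on (objects I) r"
    and "valid_path_rule I P"
  shows "(\<integral>Y. matching_weight I (random_sdmt2 I r P Y) \<partial>draws I)
           \<ge> (1 - 1 / exp 1) * opt_weight I"
proof -
  interpret house_allocation I r P using assms by unfold_locales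
  show ?thesis by (rule expected_weight_ge)
qed

end
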